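(* The algebra $\mathrm{S}(W_+)$ satisfies the ascending chain condition on Poisson ideals generated by quadratic elements: if $J_1\subseteq J_2\subseteq\cdots$ is an ascending chain of Poisson ideals of $\mathrm{S}(W_+)$, each of which is generated as a Poisson ideal by a subset of $\mathrm{S}^2(W_+)$, then $J_i=J_{i+1}$ for all $i\gg0$.
   Context: $\Bbbk$ is a field of characteristic zero. The positive Witt algebra $W_+$ is the Lie algebra over $\Bbbk$ with basis $\{e_n : n\in\mathbb{Z}_{\geq 1}\}$ and bracket $[e_i,e_j]=(j-i)e_{i+j}$. Its symmetric algebra $\mathrm{S}(W_+)$ is the polynomial ring $\Bbbk[x_1,x_2,\dots]$ ($x_i$ being the image of $e_i$), with the Poisson bracket determined by $\{x_i,x_j\}=(j-i)x_{i+j}$ and the Leibniz rule. A Poisson ideal is an ideal $I$ with $\{f,g\}\in I$ for all $f\in I$, $g\in\mathrm{S}(W_+)$; the Poisson ideal generated by a subset is the smallest Poisson ideal containing it. $\mathrm{S}^2(W_+)$ is the second symmetric power, i.e. the span of $\{x_ix_j: 1\le i\le j\}$; its elements are called quadratic. *)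

theory Defs
  imports Complex_Main "HOL-Library.Poly_Mapping"
begin

text \<open>
  The polynomial ring in the countably many variables \<open>x\<^sub>1, x\<^sub>2, \<dots>\<close> is the monoid algebra
  of the exponent vectors \<open>nat \<Rightarrow>\<^sub>0 nat\<close>.  Position \<open>k\<close> of an exponent vector is the exponent
  of \<open>x\<^bsub>k+1\<^esub>\<close>, so that the whole type is the symmetric algebra of the positive Witt algebra.
  All constants below use the original numbering, which starts at 1.
\<close>

type_synonym 'k sym_Wplus = "(nat \<Rightarrow>\<^sub>0 nat) \<Rightarrow>\<^sub>0 'k"

text \<open>\<open>xvar n\<close> is \<open>x\<^sub>n\<close> for \<open>n \<ge> 1\<close>; the value at \<open>0\<close> is never used.\<close>

definition xvar :: "nat \<Rightarrow> 'k::field_char_0 sym_Wplus" where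
  "xvar n = Poly_Mapping.single (Poly_Mapping.single (n - 1) 1) 1"

definition cmult :: "'k::field_char_0 \<Rightarrow> 'k sym_Wplus \<Rightarrow> 'k sym_Wplus" where
  "cmult c f = Poly_Mapping.single 0 c * f"

interpretation sym: vector_space "cmult :: 'k::field_char_0 \<Rightarrow> _"
proof
  fix a b :: 'k and x y :: "'k sym_Wplus"
  show "cmult a (x + y) = cmult a x + cmult a y"
    by (simp add: cmult_def algebra_simps)
  show "cmult (a + b) x = cmult a x + cmult b x"
    by (simp add: cmult_def single_add algebra_simps)
  show "cmult a (cmult b x) = cmult (a * b) x"
    by (simp add: cmult_def mult_single flip: mult.assoc)
  show "cmult 1 x = x"
    by (simp add: cmult_def)
qed

definition indets :: "'k::field_char_0 sym_Wplus \<Rightarrow> nat set" where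
  "indets f = (\<Union>m\<in>Poly_Mapping.keys f. Suc ` Poly_Mapping.keys m)"

text \<open>\<open>pd n\<close> is the formal partial derivative with respect to \<open>x\<^sub>n\<close>, for \<open>n \<ge> 1\<close>.\<close>

definition pd :: "nat \<Rightarrow> 'k::field_char_0 sym_Wplus \<Rightarrow> 'k sym_Wplus" where
  "pd n f = (\<Sum>m\<in>Poly_Mapping.keys f.
     Poly_Mapping.single (m - Poly_Mapping.single (n - 1) 1)
       (of_nat (Poly_Mapping.lookup m (n - 1)) * Poly_Mapping.lookup f m))"

text \<open>
  The only biderivation with \<open>{x\<^sub>i, x\<^sub>j} = (j - i) x\<^bsub>i+j\<^esub>\<close>, written out in coordinates;
  see \<open>pbracket_xvar\<close>, \<open>pbracket_mult_left\<close> and \<open>pbracket_unique\<close> below.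
\<close>

definition pbracket :: "'k::field_char_0 sym_Wplus \<Rightarrow> 'k sym_Wplus \<Rightarrow> 'k sym_Wplus" where
  "pbracket f g = (\<Sum>i\<in>indets f. \<Sum>j\<in>indets g.
     cmult (of_nat j - of_nat i) (xvar (i + j)) * pd i f * pd j g)"

definition poisson_ideal :: "'k::field_char_0 sym_Wplus set \<Rightarrow> bool" where
  "poisson_ideal I \<longleftrightarrow>
     0 \<in> I \<and> (\<forall>f\<in>I. \<forall>g\<in>I. f + g \<in> I) \<and> (\<forall>f\<in>I. \<forall>g. g * f \<in> I) \<and>
     (\<forall>f\<in>I. \<forall>g. pbracket f g \<in> I)"

definition poisson_ideal_generated :: "'k::field_char_0 sym_Wplus set \<Rightarrow> 'k sym_Wplus set" where
  "poisson_ideal_generated G = \<Inter>{I. poisson_ideal I \<and> G \<subseteq> I}"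

definition sym_square :: "'k::field_char_0 sym_Wplus set" where
  "sym_square = sym.span {xvar i * xvar j | i j. 1 \<le> i \<and> i \<le> j}"


subsection \<open>The bracket is the Poisson bracket\<close>

lemma poisson_ideal_generated_least:
  "poisson_ideal (poisson_ideal_generated G)" "G \<subseteq> poisson_ideal_generated G"
  "poisson_ideal I \<Longrightarrow> G \<subseteq> I \<Longrightarrow> poisson_ideal_generated G \<subseteq> I"
  by (auto simp: poisson_ideal_generated_def poisson_ideal_def)

lemma finite_indets [simp]: "finite (indets f)"
  by (simp add: indets_def)

lemma indets_pos: "i \<in> indets f \<Longrightarrow> 1 \<le> i"
  by (auto simp: indets_def)

lemma pd_superset:
  assumes "finite A" "Poly_Mapping.keys f \<subseteq> A"
  shows "pd n f = (\<Sum>m\<in>A. Poly_Mapping.single (m - Poly_Mapping.single (n - 1) 1)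
       (of_nat (Poly_Mapping.lookup m (n - 1)) * Poly_Mapping.lookup f m))"
  unfolding pd_def using assms
  by (intro sum.mono_neutral_left) (auto simp: in_keys_iff)

lemma pd_0 [simp]: "pd n 0 = 0"
  by (simp add: pd_def)

lemma pd_add: "pd n (f + g) = pd n f + pd n g"
proof -
  let ?A = "Poly_Mapping.keys f \<union> Poly_Mapping.keys g"
  have "Poly_Mapping.keys (f + g) \<subseteq> ?A" by (rule keys_add)
  then show ?thesis
    by (subst (1 2 3) pd_superset[of ?A])
      (auto simp: lookup_add algebra_simps single_add sum.distrib)
qed

lemma pd_single:
  "pd n (Poly_Mapping.single m c) =
     Poly_Mapping.single (m - Poly_Mapping.single (n - 1) 1) (of_nat (Poly_Mapping.lookup m (n - 1)) * c)"
  by (cases "c = 0") (simp_all add: pd_def)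

lemma sym_induct [case_names single add]:
  fixes f :: "'k::field_char_0 sym_Wplus"
  assumes "\<And>m c. P (Poly_Mapping.single m c)" "\<And>f g. P f \<Longrightarrow> P g \<Longrightarrow> P (f + g)"
  shows "P f"
proof (induction f rule: update_induct)
  case const
  show ?case using assms(1)[of 0 0] by simp
next
  case (update f a b)
  have "Poly_Mapping.update a b f = Poly_Mapping.single a b + f"
    using update by (intro poly_mapping_eqI)
      (auto simp: lookup_update lookup_add lookup_single in_keys_iff when_def)
  then show ?case using assms update by simp
qed

lemma exponent_minus_add:
  fixes p q :: "nat \<Rightarrow>\<^sub>0 nat"
  assumes "Poly_Mapping.lookup p k > 0"
  shows "p + q - Poly_Mapping.single k 1 = (p - Poly_Mapping.single k 1) + q"
  using assms by (intro poly_mapping_eqI) (auto simp: lookup_add lookup_minus lookup_single when_def)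

lemma pd_mult: "pd n (f * g) = pd n f * g + f * pd n g"
proof (induction f rule: sym_induct)
  case (single p a)
  show ?case
  proof (induction g rule: sym_induct)
    case (single q b)
    let ?e = "Poly_Mapping.single (n - 1) 1"
    have l: "Poly_Mapping.single (p + q - ?e) (of_nat (Poly_Mapping.lookup p (n - 1)) * (a * b)) =
        Poly_Mapping.single (p - ?e + q) (of_nat (Poly_Mapping.lookup p (n - 1)) * a * b)"
      by (cases "Poly_Mapping.lookup p (n - 1) = 0")
         (simp_all add: exponent_minus_add mult.assoc del: One_nat_def)
    have r: "Poly_Mapping.single (p + q - ?e) (of_nat (Poly_Mapping.lookup q (n - 1)) * (a * b)) =
        Poly_Mapping.single (p + (q - ?e)) (a * (of_nat (Poly_Mapping.lookup q (n - 1)) * b))"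
      by (cases "Poly_Mapping.lookup q (n - 1) = 0")
         (use exponent_minus_add[of q "n - 1" p] in \<open>simp_all add: add.commute mult_ac del: One_nat_def\<close>)
    show ?case
      unfolding pd_single mult_single lookup_add l [symmetric] r [symmetric]
      by (simp add: algebra_simps flip: single_add)
  next
    case (add g h)
    then show ?case by (simp add: pd_add algebra_simps)
  qed
next
  case (add f h)
  then show ?case by (simp add: pd_add algebra_simps)
qed

lemma pd_notin: "1 \<le> n \<Longrightarrow> n \<notin> indets f \<Longrightarrow> pd n f = 0"
proof -
  assume n: "1 \<le> n" "n \<notin> indets f"
  have "Poly_Mapping.lookup m (n - 1) = 0" if "m \<in> Poly_Mapping.keys f" for m
  proof (rule ccontr)
    assume "Poly_Mapping.lookup m (n - 1) \<noteq> 0"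
    then have "Suc (n - 1) \<in> Suc ` Poly_Mapping.keys m" by (auto simp: in_keys_iff)
    with that n show False by (auto simp: indets_def)
  qed
  then show ?thesis by (simp add: pd_def)
qed

lemma pbracket_superset:
  assumes "finite A" "indets f \<subseteq> A" "0 \<notin> A" "finite B" "indets g \<subseteq> B" "0 \<notin> B"
  shows "pbracket f g = (\<Sum>i\<in>A. \<Sum>j\<in>B. cmult (of_nat j - of_nat i) (xvar (i + j)) * pd i f * pd j g)"
proof -
  have A: "pd i f = 0" if "i \<in> A - indets f" for i
    using that assms by (intro pd_notin) (auto simp: Suc_le_eq intro: gr0I)
  have B: "pd j g = 0" if "j \<in> B - indets g" for j
    using that assms by (intro pd_notin) (auto simp: Suc_le_eq intro: gr0I)
  have "pbracket f g = (\<Sum>i\<in>indets f. \<Sum>j\<in>B. cmult (of_nat j - of_nat i) (xvar (i + j)) * pd i f * pd j g)"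
    unfolding pbracket_def using assms B by (intro sum.cong refl sum.mono_neutral_left) auto
  also have "\<dots> = (\<Sum>i\<in>A. \<Sum>j\<in>B. cmult (of_nat j - of_nat i) (xvar (i + j)) * pd i f * pd j g)"
    using assms A by (intro sum.mono_neutral_left) auto
  finally show ?thesis .
qed

lemma pbracket_anticomm: "pbracket g f = - pbracket f g"
proof -
  have c: "cmult (of_nat i - of_nat j) p = - cmult (of_nat j - of_nat i) p"
    for i j and p :: "'a::field_char_0 sym_Wplus"
    by (simp flip: sym.scale_minus_left)
  show ?thesis
    unfolding pbracket_def
    by (subst sum.swap)
       (simp add: sum_negf [symmetric] add.commute mult_ac, subst c, simp add: mult_ac)
qed

lemma pbracket_add_left: "pbracket (f + g) h = pbracket f h + pbracket g h"
proof -
  let ?A = "indets f \<union> indets g \<union> indets (f + g)"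
  have "0 \<notin> ?A" "0 \<notin> indets h" using indets_pos by force+
  then show ?thesis
    by (subst (1 2 3) pbracket_superset[of ?A _ "indets h"])
       (auto simp: pd_add distrib_left distrib_right sum.distrib)
qed

lemma pbracket_mult_left: "pbracket (f * g) h = f * pbracket g h + pbracket f h * g"
proof -
  let ?A = "indets f \<union> indets g \<union> indets (f * g)"
  have "0 \<notin> ?A" "0 \<notin> indets h" using indets_pos by force+
  then show ?thesis
    by (subst (1 2 3) pbracket_superset[of ?A _ "indets h"])
       (auto simp: pd_mult distrib_left distrib_right sum.distrib sum_distrib_left sum_distrib_right mult_ac)
qed

lemma pbracket_const_left [simp]: "pbracket (Poly_Mapping.single 0 c) h = 0"
  by (cases "c = 0") (simp_all add: pbracket_def indets_def)

lemma pbracket_cmult_left: "pbracket (cmult c f) h = cmult c (pbracket f h)"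
  by (simp add: cmult_def pbracket_mult_left)

lemma indets_xvar: "1 \<le> n \<Longrightarrow> indets (xvar n :: 'k::field_char_0 sym_Wplus) = {n}"
  by (simp add: indets_def xvar_def)

lemma pbracket_xvar:
  assumes "1 \<le> i" "1 \<le> j"
  shows "pbracket (xvar i) (xvar j) = cmult (of_nat j - of_nat i) (xvar (i + j))"
proof -
  have "pd n (xvar n :: 'a sym_Wplus) = 1" for n
    by (simp add: xvar_def pd_single)
  with assms show ?thesis by (simp add: pbracket_def indets_xvar)
qed

lemma sym_generated [case_names const xvar add mult]:
  fixes f :: "'k::field_char_0 sym_Wplus"
  assumes const: "\<And>c. P (Poly_Mapping.single 0 c)" and xvar: "\<And>n. 1 \<le> n \<Longrightarrow> P (xvar n)"
    and add: "\<And>f g. P f \<Longrightarrow> P g \<Longrightarrow> P (f + g)" and mult: "\<And>f g. P f \<Longrightarrow> P g \<Longrightarrow> P (f * g)"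
  shows "P f"
proof (induction f rule: sym_induct)
  case (single m c)
  have pow: "P (Poly_Mapping.single (Poly_Mapping.single k e) 1)" for k e
  proof (induction e)
    case 0
    show ?case using const[of 1] by simp
  next
    case (Suc e)
    have "Poly_Mapping.single (Poly_Mapping.single k (Suc e)) (1::'k) =
        xvar (Suc k) * Poly_Mapping.single (Poly_Mapping.single k e) 1"
      by (simp add: xvar_def mult_single flip: single_add)
    then show ?case using mult xvar Suc by simp
  qed
  have "P (Poly_Mapping.single m 1)"
  proof (induction m rule: update_induct)
    case const
    show ?case using assms(1)[of 1] by simp
  next
    case (update m a b)
    have "Poly_Mapping.update a b m = Poly_Mapping.single a b + m"
      using update by (intro poly_mapping_eqI)
        (auto simp: lookup_update lookup_add lookup_single in_keys_iff when_def)
    then have "Poly_Mapping.single (Poly_Mapping.update a b m) (1::'k) =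
        Poly_Mapping.single (Poly_Mapping.single a b) 1 * Poly_Mapping.single m 1"
      by (simp add: mult_single)
    then show ?case using mult pow update by simp
  qed
  then have "P (Poly_Mapping.single 0 c * Poly_Mapping.single m 1)" by (intro mult const)
  then show ?case by (simp add: mult_single)
next
  case (add f g)
  then show ?case by (rule assms(3))
qed

lemma pbracket_unique:
  fixes B :: "'k::field_char_0 sym_Wplus \<Rightarrow> 'k sym_Wplus \<Rightarrow> 'k sym_Wplus"
  assumes anticomm: "\<And>f g. B g f = - B f g"
    and add: "\<And>f g h. B (f + g) h = B f h + B g h"
    and cmult: "\<And>c f h. B (cmult c f) h = cmult c (B f h)"
    and leibniz: "\<And>f g h. B (f * g) h = f * B g h + B f h * g"
    and xvar: "\<And>i j. 1 \<le> i \<Longrightarrow> 1 \<le> j \<Longrightarrow> B (xvar i) (xvar j) = cmult (of_nat j - of_nat i) (xvar (i + j))"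
  shows "B = pbracket"
proof -
  have "B 1 h = 0" for h using leibniz[of 1 1 h] by simp
  then have const: "B (Poly_Mapping.single 0 c) h = 0" for c h
    using cmult[of c 1 h] by (simp add: cmult_def)
  have *: "B f (xvar j) = pbracket f (xvar j)" if "1 \<le> j" for f j
    by (induction f rule: sym_generated)
       (use that in \<open>simp_all add: const add leibniz xvar pbracket_add_left pbracket_mult_left pbracket_xvar\<close>)
  have "B f h = pbracket f h" for f h
  proof (induction f rule: sym_generated)
    case (xvar n)
    then show ?case using anticomm[of "xvar n" h] pbracket_anticomm[of "xvar n" h] * by simp
  qed (simp_all add: const add leibniz pbracket_add_left pbracket_mult_left)
  then show ?thesis by blast
qed

end

theory Submission
  imports Defs
begin

text \<open>
  A Poisson ideal generated by quadratic elements is determined by its quadratic part, so it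
  suffices that \<open>S\<^sup>2(W\<^sub>+)\<close> is a noetherian \<open>W\<^sub>+\<close>-module.  Identify \<open>x\<^sub>i x\<^sub>j\<close> with the symmetric
  polynomial \<open>s\<^sup>i t\<^sup>j + s\<^sup>j t\<^sup>i\<close>, up to a factor 2; then \<open>e\<^sub>k\<close> acts by
  \<open>s\<^sup>k (D\<^sub>s - k) + t\<^sup>k (D\<^sub>t - k)\<close>, where \<open>D\<^sub>s = s \<partial>/\<partial>s\<close> and \<open>D\<^sub>t = t \<partial>/\<partial>t\<close>.  Put \<open>x = st\<close> and
  \<open>d = (s - t)\<^sup>2\<close>.

  Fourth differences of the products \<open>e\<^sub>k e\<^sub>l\<close> kill all terms in which both factors act on the same
  variable.  Fourth differences of products of two such operators are multiplications, so that every
  submodule \<open>N\<close> is stable under multiplication by \<open>x\<^sup>6 d\<^sup>4 g\<close> for each symmetric \<open>g\<close>.  Hence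
  \<open>{g. (xd)\<^sup>n g h \<in> N for some n and all symmetric h}\<close> is an ideal of the ring of symmetric
  polynomials stable under \<open>D\<^sub>s + D\<^sub>t\<close> and \<open>(D\<^sub>s - D\<^sub>t)\<^sup>2\<close>, which are diagonal on the
  \<open>s\<^sup>i t\<^sup>j + s\<^sup>j t\<^sup>i\<close> with distinct pairs of eigenvalues.  If \<open>N\<close> is nonzero, the ideal therefore
  contains some \<open>s\<^sup>i t\<^sup>j + s\<^sup>j t\<^sup>i\<close>, and from this 1, so \<open>N\<close> contains all symmetric multiples of
  \<open>(xd)\<^sup>n\<close>.

  Finally, in the quotient of \<open>S\<^sup>2(W\<^sub>+)\<close> by the multiples of \<open>(xd)\<^sup>n\<close>, filter by the powers of \<open>d\<close> and
  then of \<open>x\<close>: each layer has one basis vector in each degree, and \<open>e\<^sub>k\<close> maps it to a nonzero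
  multiple of another one for all large \<open>k\<close>, so that the layers are noetherian.
\<close>

text \<open>The ring of polynomials in \<open>s, t\<close> is embedded in \<open>sym_Wplus\<close> itself as the polynomials in
  \<open>x\<^sub>1, x\<^sub>2\<close>; these copies of \<open>x\<^sub>1, x\<^sub>2\<close> have nothing to do with the elements of \<open>W\<^sub>+\<close>.\<close>

definition svar :: "'k::field_char_0 sym_Wplus" where "svar = xvar 1"
definition tvar :: "'k::field_char_0 sym_Wplus" where "tvar = xvar 2"

definition Ds :: "'k::field_char_0 sym_Wplus \<Rightarrow> 'k sym_Wplus" where "Ds f = svar * pd 1 f"
definition Dt :: "'k::field_char_0 sym_Wplus \<Rightarrow> 'k sym_Wplus" where "Dt f = tvar * pd 2 f"

section \<open>Calculus of the derivations \<open>Ds\<close> and \<open>Dt\<close>\<close>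

lemma pd_const: "pd n (Poly_Mapping.single 0 c) = 0"
  by (simp add: pd_single)

lemma pd_one: "pd n 1 = 0"
  using pd_const[of n 1] by simp

lemma pd_xvar: "1 \<le> n \<Longrightarrow> 1 \<le> i \<Longrightarrow> pd n (xvar i) = (if n = i then 1 else 0)"
  by (auto simp: xvar_def pd_single lookup_single when_def)

lemma Ds_add: "Ds (f + g) = Ds f + Ds g" and Dt_add: "Dt (f + g) = Dt f + Dt g"
  by (simp_all add: Ds_def Dt_def pd_add algebra_simps)

lemma Ds_mult: "Ds (f * g) = Ds f * g + f * Ds g" and Dt_mult: "Dt (f * g) = Dt f * g + f * Dt g"
  by (simp_all add: Ds_def Dt_def pd_mult algebra_simps)

lemma Ds_const: "Ds (Poly_Mapping.single 0 c) = 0" and Dt_const: "Dt (Poly_Mapping.single 0 c) = 0"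
  by (simp_all add: Ds_def Dt_def pd_const)

lemma Ds_svar: "Ds svar = svar" and Ds_tvar: "Ds tvar = 0"
  and Dt_svar: "Dt svar = 0" and Dt_tvar: "Dt tvar = tvar"
  by (simp_all add: Ds_def Dt_def svar_def tvar_def pd_xvar)

lemma Ds_0: "Ds 0 = 0" and Dt_0: "Dt 0 = 0"
  using Ds_add[of 0 0] Dt_add[of 0 0] by simp_all

lemma Ds_1: "Ds 1 = 0" and Dt_1: "Dt 1 = 0"
  using Ds_mult[of 1 1] Dt_mult[of 1 1] by simp_all

lemma Ds_minus: "Ds (- f) = - Ds f" and Dt_minus: "Dt (- f) = - Dt f"
  using Ds_add[of f "- f"] Dt_add[of f "- f"] by (simp_all add: Ds_0 Dt_0 eq_neg_iff_add_eq_0 add.commute)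

lemma Ds_diff: "Ds (f - g) = Ds f - Ds g" and Dt_diff: "Dt (f - g) = Dt f - Dt g"
  using Ds_add[of f "- g"] Dt_add[of f "- g"] by (simp_all add: Ds_minus Dt_minus)

lemma Ds_of_nat: "Ds (of_nat n) = 0" and Dt_of_nat: "Dt (of_nat n) = 0"
  by (induction n) (simp_all add: Ds_0 Dt_0 Ds_1 Dt_1 Ds_add Dt_add)

lemma Ds_numeral: "Ds (numeral n) = 0" and Dt_numeral: "Dt (numeral n) = 0"
  using Ds_of_nat[of "numeral n"] Dt_of_nat[of "numeral n"] by simp_all

lemma Ds_s_power: "Ds (svar ^ n) = of_nat n * svar ^ n"
  and Ds_t_power: "Ds (tvar ^ n) = 0"
  and Dt_s_power: "Dt (svar ^ n) = 0"
  and Dt_t_power: "Dt (tvar ^ n) = of_nat n * tvar ^ n"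
  by (induction n; simp add: Ds_1 Dt_1 Ds_mult Dt_mult Ds_svar Ds_tvar Dt_svar Dt_tvar algebra_simps)+

lemma Ds_Dt_commute: "Ds (Dt f) = Dt (Ds f)"
proof (induction f rule: sym_generated)
  case (const c)
  show ?case by (simp add: Ds_const Dt_const Ds_0 Dt_0)
next
  case (xvar n)
  then show ?case
    by (simp add: Ds_def Dt_def svar_def tvar_def pd_xvar pd_mult pd_one)
next
  case (add f g)
  then show ?case by (simp add: Ds_add Dt_add)
next
  case (mult f g)
  then show ?case by (simp add: Ds_add Dt_add Ds_mult Dt_mult algebra_simps)
qed

lemmas D_simps = Ds_add Dt_add Ds_mult Dt_mult Ds_diff Dt_diff Ds_minus Dt_minus Ds_svar Ds_tvar
  Dt_svar Dt_tvar Ds_0 Dt_0 Ds_1 Dt_1 Ds_of_nat Dt_of_nat Ds_numeral Dt_numeral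
  Ds_s_power Ds_t_power Dt_s_power Dt_t_power Ds_Dt_commute

section \<open>The action on polynomials in s and t, and fourth differences\<close>

definition act :: "nat \<Rightarrow> 'k::field_char_0 sym_Wplus \<Rightarrow> 'k sym_Wplus" where
  "act k f = svar ^ k * Ds f + tvar ^ k * Dt f - of_nat k * (svar ^ k + tvar ^ k) * f"

text \<open>The bidifferential operator \<open>(D\<^sub>s - D\<^sub>s')(D\<^sub>t - D\<^sub>t')\<close>, the unprimed derivations acting on \<open>f\<close>
  and the primed ones on \<open>p\<close>.  At \<open>p = s\<^sup>k t\<^sup>l\<close> it is \<open>s\<^sup>k (D\<^sub>s - k)\<close> composed with \<open>t\<^sup>l (D\<^sub>t - l)\<close>.\<close>

definition cross_op :: "'k::field_char_0 sym_Wplus \<Rightarrow> 'k sym_Wplus \<Rightarrow> 'k sym_Wplus" where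
  "cross_op p f = p * Ds (Dt f) - Ds p * Dt f - Dt p * Ds f + Ds (Dt p) * f"

definition msym :: "nat \<Rightarrow> nat \<Rightarrow> 'k::field_char_0 sym_Wplus" where
  "msym i j = svar ^ i * tvar ^ j + svar ^ j * tvar ^ i"

definition st :: "'k::field_char_0 sym_Wplus" where "st = svar * tvar"
definition disc :: "'k::field_char_0 sym_Wplus" where "disc = (svar - tvar)\<^sup>2"

text \<open>Splits off the terms in which both operators hit the same variable. For fixed
  \<open>k + l\<close> their coefficients are polynomials of degree at most two in \<open>l\<close>;
  the mixed terms form a bidifferential operator in the symbol \<open>msym k l\<close>.\<close>

lemma act_act:
  "act k (act l f) =
     svar ^ (k + l) * (Ds (Ds f) - of_nat k * Ds f - of_nat l * (of_nat l - of_nat k) * f) +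
     tvar ^ (k + l) * (Dt (Dt f) - of_nat k * Dt f - of_nat l * (of_nat l - of_nat k) * f) +
     cross_op (msym k l) f"
  by (simp add: act_def cross_op_def msym_def D_simps power_add algebra_simps)

lemma cross_op_add_left: "cross_op (p + q) f = cross_op p f + cross_op q f"
  by (simp add: cross_op_def D_simps algebra_simps)
lemma cross_op_diff_left: "cross_op (p - q) f = cross_op p f - cross_op q f"
  by (simp add: cross_op_def D_simps algebra_simps)
lemma cross_op_numeral_left: "cross_op (numeral n * p) f = numeral n * cross_op p f"
  by (simp add: cross_op_def D_simps algebra_simps)

lemma msym_disc2:
  "disc\<^sup>2 * msym u v = msym u (v+4) - 4 * msym (u+1) (v+3) + 6 * msym (u+2) (v+2)
     - 4 * msym (u+3) (v+1) + msym (u+4) v"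
  by (simp add: msym_def disc_def power_add power2_eq_square eval_nat_numeral algebra_simps)

text \<open>Along constant \<open>k + l\<close>, the fourth difference kills the same-variable terms
  of \<open>act_act\<close> and, by the binomial expansion of \<open>(svar - tvar) ^ 4\<close>,
  multiplies the symbol by \<open>disc\<^sup>2\<close>.\<close>

lemma fourth_difference_act:
  "act u (act (v+4) f) - 4 * act (u+1) (act (v+3) f) + 6 * act (u+2) (act (v+2) f)
     - 4 * act (u+3) (act (v+1) f) + act (u+4) (act v f) = cross_op (disc\<^sup>2 * msym u v) f"
proof -
  have e: "u + (v+4) = u+v+4" "u + 1 + (v+3) = u+v+4" "u + 2 + (v+2) = u+v+4"
    "u + 3 + (v+1) = u+v+4" "u + 4 + v = u+v+4" by simp_all
  show ?thesis
    unfolding act_act msym_disc2 cross_op_add_left cross_op_diff_left cross_op_numeral_left e of_nat_add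
    by (simp add: algebra_simps)
qed

definition euler :: "'k::field_char_0 sym_Wplus \<Rightarrow> 'k sym_Wplus" where
  "euler f = Ds f + Dt f"

lemma Ds_st_power: "Ds (st ^ n) = of_nat n * st ^ n" and Dt_st_power: "Dt (st ^ n) = of_nat n * st ^ n"
  by (simp_all add: st_def power_mult_distrib D_simps)

text \<open>Both \<open>Ds\<close> and \<open>Dt\<close> have \<open>st\<close> as an eigenvector of
  eigenvalue 1, so powers of \<open>st\<close> merely shift both factors of the bidifferential
  operator by \<open>j - i\<close>. The result is quadratic in this shift.\<close>

lemma cross_op_st_power:
  "cross_op (st ^ i * a) (st ^ j * h) = st ^ (i + j) *
     (cross_op a h + (of_nat j - of_nat i) * (a * euler h - euler a * h) + (of_nat j - of_nat i)\<^sup>2 * a * h)"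
  by (simp add: cross_op_def euler_def D_simps Ds_st_power Dt_st_power power_add power2_eq_square algebra_simps)

lemma cross_op_add_right: "cross_op p (f + g) = cross_op p f + cross_op p g"
  by (simp add: cross_op_def D_simps algebra_simps)
lemma cross_op_diff_right: "cross_op p (f - g) = cross_op p f - cross_op p g"
  by (simp add: cross_op_def D_simps algebra_simps)
lemma cross_op_numeral_right: "cross_op p (numeral n * f) = numeral n * cross_op p f"
  by (simp add: cross_op_def D_simps algebra_simps)
lemma euler_add: "euler (f + g) = euler f + euler g"
  by (simp add: euler_def D_simps algebra_simps)
lemma euler_diff: "euler (f - g) = euler f - euler g"
  by (simp add: euler_def D_simps algebra_simps)
lemma euler_numeral: "euler (numeral n * f) = numeral n * euler f"
  by (simp add: euler_def D_simps algebra_simps)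

text \<open>With \<open>st ^ j\<close> in the inner symbol and \<open>st ^ (4 - j)\<close> in the
  outer one, the inner operator is quadratic in j and the outer one quadratic in 2j - 4. Only the
  quartic term, with coefficient \<open>4 * a * b * f\<close>, survives a fourth difference, and 4 *
  4! = 96.\<close>

lemma fourth_difference_cross_op:
  "cross_op (st ^ 4 * a) (cross_op b f) - 4 * cross_op (st ^ 3 * a) (cross_op (st * b) f)
     + 6 * cross_op (st ^ 2 * a) (cross_op (st ^ 2 * b) f)
     - 4 * cross_op (st * a) (cross_op (st ^ 3 * b) f) + cross_op a (cross_op (st ^ 4 * b) f)
   = 96 * st ^ 4 * a * b * f"
proof -
  define p q r where "p = cross_op b f" and "q = b * euler f - euler b * f" and "r = b * f"
  have inner: "cross_op (st ^ j * b) f = st ^ j * (p - of_nat j * q + (of_nat j)\<^sup>2 * r)" for j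
    using cross_op_st_power[of j b 0 f] by (simp add: p_def q_def r_def algebra_simps)
  have i: "cross_op b f = st ^ 0 * p" "cross_op (st * b) f = st ^ 1 * (p - q + r)"
    "cross_op (st ^ 2 * b) f = st ^ 2 * (p - 2 * q + 4 * r)"
    "cross_op (st ^ 3 * b) f = st ^ 3 * (p - 3 * q + 9 * r)"
    "cross_op (st ^ 4 * b) f = st ^ 4 * (p - 4 * q + 16 * r)"
    using inner[of 0] inner[of 1] inner[of 2] inner[of 3] inner[of 4] by simp_all
  have o: "cross_op a h = cross_op (st ^ 0 * a) h" "cross_op (st * a) h = cross_op (st ^ 1 * a) h" for h
    by simp_all
  have "?thesis \<longleftrightarrow> cross_op (st ^ 4 * a) (st ^ 0 * p) - 4 * cross_op (st ^ 3 * a) (st ^ 1 * (p - q + r))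
     + 6 * cross_op (st ^ 2 * a) (st ^ 2 * (p - 2 * q + 4 * r))
     - 4 * cross_op (st ^ 1 * a) (st ^ 3 * (p - 3 * q + 9 * r)) + cross_op (st ^ 0 * a) (st ^ 4 * (p - 4 * q + 16 * r))
     = 96 * st ^ 4 * a * r"
    unfolding i o by (simp add: r_def mult.assoc)
  also have \<dots>
    unfolding cross_op_st_power cross_op_add_right cross_op_diff_right cross_op_numeral_right euler_add euler_diff euler_numeral
    by (simp add: power2_eq_square algebra_simps)
  finally show ?thesis by blast
qed

subsection \<open>Symmetric polynomials\<close>

lemma cmult_mult_left: "cmult c f * g = cmult c (f * g)"
  and cmult_mult_right: "f * cmult c g = cmult c (f * g)"
  by (simp_all add: cmult_def mult_ac)

lemma cmult_of_nat: "cmult (of_nat n) f = of_nat n * f"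
  by (simp add: cmult_def)

lemma cmult_numeral: "cmult (numeral n) f = numeral n * f"
  using cmult_of_nat[of "numeral n" f] by simp

lemma Ds_cmult: "Ds (cmult c f) = cmult c (Ds f)" and Dt_cmult: "Dt (cmult c f) = cmult c (Dt f)"
  by (simp_all add: cmult_def Ds_mult Dt_mult Ds_const Dt_const)

lemma act_add: "act k (f + g) = act k f + act k g"
  by (simp add: act_def D_simps algebra_simps)

lemma act_cmult: "act k (cmult c f) = cmult c (act k f)"
  by (simp add: act_def Ds_cmult Dt_cmult cmult_mult_left cmult_mult_right sym.scale_right_distrib sym.scale_right_diff_distrib)

lemma subspace_of_nat_mult: "sym.subspace N \<Longrightarrow> f \<in> N \<Longrightarrow> of_nat n * f \<in> N"
  by (metis cmult_of_nat sym.subspace_scale)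

lemma subspace_numeral_mult: "sym.subspace N \<Longrightarrow> f \<in> N \<Longrightarrow> numeral n * f \<in> N"
  by (metis cmult_numeral sym.subspace_scale)

lemma subspace_of_nat_cancel:
  assumes "sym.subspace N" "of_nat n * f \<in> N" "n \<noteq> 0"
  shows "f \<in> N"
proof -
  have "cmult (1 / of_nat n) (cmult (of_nat n) f) \<in> N"
    using sym.subspace_scale[OF assms(1,2), of "1 / of_nat n"] by (simp only: cmult_of_nat)
  moreover have "cmult (1 / of_nat n) (cmult (of_nat n) f) = f"
    using assms(3) by simp
  ultimately show ?thesis by simp
qed

lemma subspace_numeral_cancel:
  "sym.subspace N \<Longrightarrow> numeral n * f \<in> N \<Longrightarrow> f \<in> N"
  using subspace_of_nat_cancel[of N "numeral n" f] by simp

text \<open>The symmetric polynomials in s and t. The diagonal generators \<open>msym i i\<close>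
  are twice a monomial, which spans the same line in characteristic zero.\<close>

definition Sym :: "'k::field_char_0 sym_Wplus set" where
  "Sym = sym.span {msym i j | i j. True}"

lemma subspace_Sym: "sym.subspace Sym"
  by (simp add: Sym_def sym.subspace_span)

lemmas Sym_add = sym.subspace_add[OF subspace_Sym]
  and Sym_diff = sym.subspace_diff[OF subspace_Sym]
  and Sym_cmult = sym.subspace_scale[OF subspace_Sym]
  and Sym_0 = sym.subspace_0[OF subspace_Sym]

lemma msym_Sym: "msym i j \<in> Sym"
  unfolding Sym_def by (rule sym.span_base) auto

lemma Sym_induct [consumes 1, case_names zero add]:
  assumes "g \<in> Sym" "P 0" "\<And>c i j g. g \<in> Sym \<Longrightarrow> P g \<Longrightarrow> P (cmult c (msym i j) + g)"
  shows "P g"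
proof -
  have "g \<in> Sym \<and> P g"
    using assms(1) unfolding Sym_def
  proof (induction rule: sym.span_induct_alt)
    case base
    then show ?case using assms(2) sym.span_zero by blast
  next
    case (step c x y)
    then obtain i j where "x = msym i j" by blast
    then show ?case
      using step assms(3)[of y c i j] Sym_add[OF Sym_cmult[OF msym_Sym[of i j], of c], of y]
      unfolding Sym_def by blast
  qed
  then show ?thesis ..
qed

lemma msym_mult: "msym i j * msym k l = msym (i + k) (j + l) + msym (i + l) (j + k)"
  by (simp add: msym_def power_add algebra_simps)

lemma Sym_mult: "f \<in> Sym \<Longrightarrow> g \<in> Sym \<Longrightarrow> f * g \<in> Sym"
proof (induction rule: Sym_induct)
  case zero
  then show ?case by (simp add: Sym_0)
next
  case (add c i j f)
  from \<open>g \<in> Sym\<close> have "msym i j * g \<in> Sym"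
    by (induction rule: Sym_induct)
      (auto simp: Sym_0 distrib_left cmult_mult_right msym_mult intro!: Sym_add Sym_cmult msym_Sym)
  with add show ?case
    by (auto simp: distrib_right cmult_mult_left intro!: Sym_add Sym_cmult)
qed

lemma Sym_of_nat_mult: "g \<in> Sym \<Longrightarrow> of_nat n * g \<in> Sym"
  by (rule subspace_of_nat_mult[OF subspace_Sym])

lemma Sym_numeral_mult: "g \<in> Sym \<Longrightarrow> numeral n * g \<in> Sym"
  by (rule subspace_numeral_mult[OF subspace_Sym])

lemma Sym_1: "1 \<in> Sym"
  by (rule subspace_numeral_cancel[OF subspace_Sym, of "Num.Bit0 Num.One"])
     (use msym_Sym[of 0 0] in \<open>simp add: msym_def\<close>)

lemma Sym_power: "g \<in> Sym \<Longrightarrow> g ^ n \<in> Sym"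
  by (induction n) (auto intro: Sym_1 Sym_mult)

lemma st_Sym: "st \<in> Sym"
  by (rule subspace_numeral_cancel[OF subspace_Sym, of "Num.Bit0 Num.One"])
     (use msym_Sym[of 1 1] in \<open>simp add: msym_def st_def\<close>)

lemma disc_Sym: "(disc :: 'k::field_char_0 sym_Wplus) \<in> Sym"
proof -
  have "(disc :: 'k sym_Wplus) = msym 2 0 - msym 1 1"
    by (simp add: disc_def msym_def power2_eq_square algebra_simps)
  show ?thesis
    by (subst \<open>disc = _\<close>) (intro Sym_diff msym_Sym)
qed

definition act_subspace :: "'k::field_char_0 sym_Wplus set \<Rightarrow> bool" where
  "act_subspace N \<longleftrightarrow> sym.subspace N \<and> (\<forall>k\<ge>1. \<forall>f\<in>N. act k f \<in> N)"

lemma act_subspace_subspace: "act_subspace N \<Longrightarrow> sym.subspace N"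
  and act_subspace_act: "act_subspace N \<Longrightarrow> 1 \<le> k \<Longrightarrow> f \<in> N \<Longrightarrow> act k f \<in> N"
  by (simp_all add: act_subspace_def)

lemma st_msym: "st ^ n * msym i j = msym (n + i) (n + j)"
  by (simp add: st_def msym_def power_mult_distrib power_add algebra_simps)

lemma act_subspace_cross_op:
  assumes "act_subspace N" "1 \<le> u" "1 \<le> v" "f \<in> N"
  shows "cross_op (disc\<^sup>2 * msym u v) f \<in> N"
proof -
  note N = act_subspace_subspace[OF assms(1)]
  show ?thesis unfolding fourth_difference_act[symmetric]
    using assms by (intro sym.subspace_add[OF N] sym.subspace_diff[OF N] subspace_numeral_mult[OF N]
      act_subspace_act[OF assms(1)]) auto
qed

text \<open>\<open>fourth_difference_cross_op\<close> turns compositions of operators preserving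
  \<open>N\<close> into a multiplication, here for the symbols
  \<open>disc\<^sup>2 * msym u v\<close> and \<open>disc\<^sup>2 * msym 1 1\<close>.\<close>

lemma act_subspace_msym_mult:
  fixes f :: "'k::field_char_0 sym_Wplus"
  assumes N: "act_subspace N" and uv: "1 \<le> u" "1 \<le> v" and f: "f \<in> N"
  shows "st ^ 5 * disc ^ 4 * msym u v * f \<in> N"
proof -
  note S = act_subspace_subspace[OF N]
  \<comment> \<open>Powers of \<open>st\<close> are absorbed into the indices of
    \<open>msym\<close>.\<close>
  have c: "cross_op (st ^ i * (disc\<^sup>2 * msym a b)) g \<in> N" if "1 \<le> a" "1 \<le> b" "g \<in> N" for i a b g
    using act_subspace_cross_op[OF N, of "i + a" "i + b" g] that
    by (simp add: mult.left_commute[of "st ^ i"] st_msym)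
  have c0: "cross_op (disc\<^sup>2 * msym a b) g \<in> N" "cross_op (st * (disc\<^sup>2 * msym a b)) g \<in> N"
    if "1 \<le> a" "1 \<le> b" "g \<in> N" for a b g
    using c[of a b g 0] c[of a b g 1] that by simp_all
  have "96 * st ^ 4 * (disc\<^sup>2 * msym u v) * (disc\<^sup>2 * msym 1 1) * f \<in> N"
    unfolding fourth_difference_cross_op[symmetric]
    by (intro sym.subspace_add[OF S] sym.subspace_diff[OF S] subspace_numeral_mult[OF S] c c0 uv f) auto
  \<comment> \<open>The factor \<open>msym 1 1 = 2 * st\<close> accounts for the fifth power of
    \<open>st\<close> and for 192 = 2 * 96.\<close>
  also have "96 * st ^ 4 * (disc\<^sup>2 * msym u v) * (disc\<^sup>2 * msym 1 1) * f =
      192 * (st ^ 5 * disc ^ 4 * msym u v * f)"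
  proof -
    have "msym 1 1 = 2 * (st :: 'k sym_Wplus)" by (simp add: msym_def st_def)
    then show ?thesis by (simp add: algebra_simps eval_nat_numeral)
  qed
  finally show ?thesis by (rule subspace_numeral_cancel[OF S])
qed

text \<open>One more factor \<open>st\<close> raises both exponents of \<open>msym i j\<close> by
  one, into the range of \<open>act_subspace_msym_mult\<close>.\<close>

lemma act_subspace_Sym_mult:
  assumes N: "act_subspace N" and f: "f \<in> N" and g: "g \<in> Sym"
  shows "st ^ 6 * disc ^ 4 * g * f \<in> N"
  using g
proof (induction rule: Sym_induct)
  case zero
  then show ?case using act_subspace_subspace[OF N] sym.subspace_0 by simp
next
  case (add c i j g)
  have "st ^ 5 * disc ^ 4 * msym (1 + i) (1 + j) * f \<in> N"
    by (rule act_subspace_msym_mult[OF N _ _ f]) auto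
  then have "st ^ 6 * disc ^ 4 * msym i j * f \<in> N"
    unfolding st_msym[of 1, symmetric] by (simp add: algebra_simps eval_nat_numeral)
  then have "cmult c (st ^ 6 * disc ^ 4 * msym i j * f) + st ^ 6 * disc ^ 4 * g * f \<in> N"
    using add act_subspace_subspace[OF N] by (intro sym.subspace_add sym.subspace_scale)
  then show ?case
    by (simp add: distrib_left distrib_right cmult_mult_left cmult_mult_right)
qed

subsection \<open>The saturated ideal of a submodule\<close>

text \<open>The vector field with components \<open>svar ^ (k + 1)\<close> and
  \<open>tvar ^ (k + 1)\<close>: the derivation part of \<open>act k\<close>.\<close>

definition theta :: "nat \<Rightarrow> 'k::field_char_0 sym_Wplus \<Rightarrow> 'k sym_Wplus" where
  "theta k f = svar ^ k * Ds f + tvar ^ k * Dt f"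

text \<open>The complete homogeneous symmetric polynomial of degree \<open>k\<close> in two
  variables.\<close>

definition hsum :: "nat \<Rightarrow> 'k::field_char_0 sym_Wplus" where
  "hsum k = (\<Sum>i<Suc k. svar ^ i * tvar ^ (k - i))"

lemma act_theta: "act k f = theta k f - of_nat k * msym k 0 * f"
  by (simp add: act_def theta_def msym_def)

lemma theta_add: "theta k (f + g) = theta k f + theta k g"
  and theta_mult: "theta k (f * g) = theta k f * g + f * theta k g"
  and theta_cmult: "theta k (cmult c f) = cmult c (theta k f)"
  by (simp_all add: theta_def D_simps Ds_cmult Dt_cmult cmult_mult_right sym.scale_right_distrib algebra_simps)

lemma theta_0: "theta k 0 = 0"
  by (simp add: theta_def D_simps)

lemma theta_msym: "theta k (msym i j) = of_nat i * msym (i + k) j + of_nat j * msym i (j + k)"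
  by (simp add: theta_def msym_def D_simps power_add algebra_simps)

lemma theta_Sym: "g \<in> Sym \<Longrightarrow> theta k g \<in> Sym"
  by (induction rule: Sym_induct)
     (auto simp: theta_0 theta_add theta_cmult theta_msym Sym_0
       intro!: Sym_add Sym_cmult Sym_of_nat_mult msym_Sym)

lemma msym_commute: "msym i j = msym j i"
  by (simp add: msym_def algebra_simps)

lemma two_hsum: "2 * hsum k = (\<Sum>i<Suc k. msym i (k - i))"
proof -
  have "(\<Sum>i<Suc k. svar ^ i * tvar ^ (k - i)) = (\<Sum>i<Suc k. svar ^ (k - i) * tvar ^ i :: 'a sym_Wplus)"
    by (rule sum.reindex_bij_witness[of _ "\<lambda>i. k - i" "\<lambda>i. k - i"]) auto
  then show ?thesis
    by (simp only: hsum_def msym_def sum.distrib mult_2)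
qed

lemma hsum_Sym: "hsum k \<in> Sym"
  by (rule subspace_numeral_cancel[OF subspace_Sym, of "Num.Bit0 Num.One"], unfold two_hsum)
     (intro sym.subspace_sum subspace_Sym msym_Sym)

lemma power_diff_hsum: "svar ^ Suc k - tvar ^ Suc k = (svar - tvar) * hsum k"
  unfolding hsum_def by (rule diff_power_eq_sum)

lemma theta_disc: "theta k disc = 2 * hsum k * disc"
proof -
  have "theta k disc = 2 * (svar - tvar) * (svar ^ Suc k - tvar ^ Suc k)"
    by (simp add: theta_def disc_def power2_eq_square D_simps algebra_simps)
  then show ?thesis
    unfolding power_diff_hsum by (simp add: disc_def power2_eq_square algebra_simps)
qed

lemma theta_power: "theta k (f ^ Suc n) = of_nat (Suc n) * f ^ n * theta k f"
proof (induction n)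
  case (Suc n)
  have "theta k (f ^ Suc (Suc n)) = theta k f * f ^ Suc n + f * theta k (f ^ Suc n)"
    by (simp only: power_Suc[of f "Suc n"] theta_mult)
  with Suc show ?case by (simp add: algebra_simps)
qed simp

lemma theta_1: "theta k 1 = 0"
  by (simp add: theta_def D_simps)

lemma theta_disc_power: "theta k (disc ^ n) = of_nat n * (2 * hsum k) * disc ^ n"
  by (cases n) (simp_all add: theta_power theta_disc theta_1 algebra_simps del: power_Suc, simp add: algebra_simps)

lemma theta_st_power: "theta k (st ^ n) = of_nat n * msym k 0 * st ^ n"
  by (simp add: theta_def Ds_st_power Dt_st_power msym_def algebra_simps)

text \<open>The logarithmic derivatives of \<open>st\<close> and \<open>disc\<close> along
  \<open>theta k\<close> are the symmetric polynomials \<open>msym k 0\<close> and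
  \<open>2 * hsum k\<close>. Hence \<open>st ^ p * disc ^ q\<close> can be pulled out of the
  action.\<close>

lemma act_weight:
  "act k (st ^ p * disc ^ q * g) = st ^ p * disc ^ q *
    (of_nat p * msym k 0 * g + of_nat q * (2 * hsum k) * g + theta k g - of_nat k * msym k 0 * g)"
  by (simp add: act_theta theta_mult theta_st_power theta_disc_power algebra_simps)

text \<open>The saturation at \<open>st \<cdot> disc\<close> of the largest ideal of \<open>Sym\<close> contained in \<open>N\<close>.\<close>

definition sat :: "'k::field_char_0 sym_Wplus set \<Rightarrow> 'k sym_Wplus set" where
  "sat N = {g \<in> Sym. \<exists>n. \<forall>h\<in>Sym. st ^ n * disc ^ n * h * g \<in> N}"

lemma sat_Sym: "g \<in> sat N \<Longrightarrow> g \<in> Sym"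
  by (simp add: sat_def)

lemma sat_mono_exponent:
  assumes "\<forall>h\<in>Sym. st ^ n * disc ^ n * h * g \<in> N" "n \<le> m" "h \<in> Sym"
  shows "st ^ m * disc ^ m * h * g \<in> N"
proof -
  have "st ^ (m - n) * disc ^ (m - n) * h \<in> Sym"
    using assms(3) by (intro Sym_mult Sym_power st_Sym disc_Sym)
  with assms(1) have "st ^ n * disc ^ n * (st ^ (m - n) * disc ^ (m - n) * h) * g \<in> N" by blast
  also have "st ^ n * disc ^ n * (st ^ (m - n) * disc ^ (m - n) * h) * g = st ^ (n + (m - n)) * disc ^ (n + (m - n)) * h * g"
    by (simp add: power_add mult_ac del: le_add_diff_inverse le_add_diff_inverse2)
  finally show ?thesis using assms(2) by simp
qed

lemma sat_add:
  assumes N: "act_subspace N" and "f \<in> sat N" "g \<in> sat N"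
  shows "f + g \<in> sat N"
proof -
  from assms obtain a b where
    a: "\<forall>h\<in>Sym. st ^ a * disc ^ a * h * f \<in> N" and b: "\<forall>h\<in>Sym. st ^ b * disc ^ b * h * g \<in> N"
    by (auto simp: sat_def)
  have "\<forall>h\<in>Sym. st ^ max a b * disc ^ max a b * h * (f + g) \<in> N"
    using sat_mono_exponent[OF a, of "max a b"] sat_mono_exponent[OF b, of "max a b"]
    by (auto simp: distrib_left intro!: sym.subspace_add[OF act_subspace_subspace[OF N]])
  then show ?thesis using assms by (auto simp: sat_def intro: Sym_add)
qed

lemma sat_mult:
  assumes "f \<in> Sym" "g \<in> sat N"
  shows "f * g \<in> sat N"
proof -
  from assms obtain a where a: "\<forall>h\<in>Sym. st ^ a * disc ^ a * h * g \<in> N"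
    by (auto simp: sat_def)
  then have "\<forall>h\<in>Sym. st ^ a * disc ^ a * h * (f * g) \<in> N"
    using Sym_mult[OF _ assms(1)] by (metis mult.assoc)
  then show ?thesis using assms by (auto simp: sat_def intro: Sym_mult)
qed

lemma subspace_sat: "act_subspace N \<Longrightarrow> sym.subspace (sat N)"
proof (rule sym.subspaceI)
  fix c :: 'a and g :: "'a sym_Wplus" assume "g \<in> sat N"
  then have "cmult c 1 * g \<in> sat N" by (intro sat_mult Sym_cmult Sym_1)
  then show "cmult c g \<in> sat N" by (simp add: cmult_mult_left)
next
  assume "act_subspace N"
  then show "0 \<in> sat N" by (simp add: sat_def Sym_0 act_subspace_subspace sym.subspace_0)
qed (rule sat_add)

lemma sat_cancel:
  assumes "st * disc * g \<in> sat N" "g \<in> Sym"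
  shows "g \<in> sat N"
proof -
  from assms obtain a where a: "\<forall>h\<in>Sym. st ^ a * disc ^ a * h * (st * disc * g) \<in> N"
    by (auto simp: sat_def)
  then have "\<forall>h\<in>Sym. st ^ Suc a * disc ^ Suc a * h * g \<in> N"
    by (simp add: mult_ac)
  with assms(2) show ?thesis unfolding sat_def by blast
qed

lemma sat_cancel_st:
  assumes "st * g \<in> sat N" "g \<in> Sym"
  shows "g \<in> sat N"
  using sat_mult[OF disc_Sym assms(1)] assms(2) by (auto intro: sat_cancel simp: mult_ac)

lemma sat_cancel_disc:
  assumes "disc * g \<in> sat N" "g \<in> Sym"
  shows "g \<in> sat N"
  using sat_mult[OF st_Sym assms(1)] assms(2) by (auto intro: sat_cancel simp: mult_ac)

lemma sat_cancel_st_power: "st ^ n * g \<in> sat N \<Longrightarrow> g \<in> Sym \<Longrightarrow> g \<in> sat N"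
proof (induction n)
  case (Suc n)
  have "st ^ n * g \<in> sat N"
  proof (rule sat_cancel_st)
    show "st * (st ^ n * g) \<in> sat N" using Suc.prems(1) by (simp add: mult.assoc)
  qed (intro Sym_mult Sym_power st_Sym Suc.prems(2))
  then show ?case using Suc by blast
qed simp

lemma sat_act_subspace:
  assumes N: "act_subspace N" "f \<in> N" "f \<in> Sym"
  shows "f \<in> sat N"
proof -
  \<comment> \<open>\<open>sat\<close> asks for a common exponent, so the missing
    \<open>disc\<^sup>2\<close> is moved into \<open>h\<close>.\<close>
  have "st ^ 6 * disc ^ 6 * h * f \<in> N" if "h \<in> Sym" for h
  proof -
    have "disc\<^sup>2 * h \<in> Sym" using that by (intro Sym_mult Sym_power disc_Sym)
    from act_subspace_Sym_mult[OF N(1,2) this] show ?thesis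
      by (simp add: mult_ac eval_nat_numeral)
  qed
  with N(3) show ?thesis by (auto simp: sat_def)
qed

lemma sat_theta:
  assumes N: "act_subspace N" and k: "1 \<le> k" and g: "g \<in> sat N"
  shows "theta k g \<in> sat N"
proof -
  note S = act_subspace_subspace[OF N]
  from g obtain n where n: "\<And>h. h \<in> Sym \<Longrightarrow> st ^ n * disc ^ n * h * g \<in> N"
    by (auto simp: sat_def)
  have "st ^ n * disc ^ n * h * theta k g \<in> N" if h: "h \<in> Sym" for h
  proof -
    \<comment> \<open>\<open>u * g\<close> collects the terms in which the derivation does not hit
      \<open>g\<close>; they are symmetric multiples of \<open>g\<close>, hence harmless.\<close>
    define u where "u = of_nat n * (msym k 0 * h) + of_nat n * (2 * hsum k * h) + theta k h - of_nat k * (msym k 0 * h)"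
    have "u \<in> Sym"
      unfolding u_def using h
      by (intro Sym_add Sym_diff Sym_of_nat_mult Sym_mult theta_Sym msym_Sym hsum_Sym Sym_numeral_mult)
    then have "act k (st ^ n * disc ^ n * h * g) - st ^ n * disc ^ n * u * g \<in> N"
      using n h by (intro sym.subspace_diff[OF S] act_subspace_act[OF N k]) auto
    also have "act k (st ^ n * disc ^ n * h * g) - st ^ n * disc ^ n * u * g = st ^ n * disc ^ n * h * theta k g"
      using act_weight[of k n n "h * g"] by (simp add: u_def theta_mult algebra_simps)
    finally show ?thesis .
  qed
  with g show ?thesis by (auto simp: sat_def intro: theta_Sym)
qed

section \<open>Diagonal operators preserving the saturation\<close>

lemma euler_msym: "euler (msym i j) = cmult (of_nat (i + j)) (msym i j)"
  by (simp only: cmult_of_nat) (simp add: euler_def msym_def D_simps algebra_simps)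

lemma euler_cmult: "euler (cmult c f) = cmult c (euler f)"
  by (simp add: euler_def Ds_cmult Dt_cmult sym.scale_right_distrib)

lemma euler_Sym: "g \<in> Sym \<Longrightarrow> euler g \<in> Sym"
  by (induction rule: Sym_induct)
    (auto simp: euler_add euler_cmult euler_msym Sym_0 intro!: Sym_add Sym_cmult msym_Sym,
      simp add: euler_def D_simps Sym_0)

text \<open>A combination of \<open>theta 1\<close> and \<open>theta 2\<close> with symmetric
  coefficients equals \<open>st * euler\<close>, and \<open>st\<close> can be cancelled.\<close>

lemma sat_euler:
  assumes N: "act_subspace N" and g: "g \<in> sat N"
  shows "euler g \<in> sat N"
proof (rule sat_cancel_st)
  have "msym 1 0 * theta 1 g - theta 2 g \<in> sat N"
    using g by (intro sym.subspace_diff[OF subspace_sat[OF N]] sat_mult msym_Sym sat_theta[OF N]) auto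
  also have "msym 1 0 * theta 1 g - theta 2 g = st * euler g"
    by (simp add: msym_def theta_def euler_def st_def power2_eq_square algebra_simps)
  finally show "st * euler g \<in> sat N" .
qed (use g in \<open>simp add: euler_Sym sat_Sym\<close>)

text \<open>Swapping s and t changes the sign of \<open>Ds - Dt\<close>; the factor
  \<open>svar - tvar\<close> restores symmetry.\<close>

definition skew_euler :: "'k::field_char_0 sym_Wplus \<Rightarrow> 'k sym_Wplus" where
  "skew_euler f = (svar - tvar) * (Ds f - Dt f)"

definition skew_square :: "'k::field_char_0 sym_Wplus \<Rightarrow> 'k sym_Wplus" where
  "skew_square f = Ds (Ds f - Dt f) - Dt (Ds f - Dt f)"

lemma sat_skew_euler:
  assumes N: "act_subspace N" and g: "g \<in> sat N"
  shows "skew_euler g \<in> sat N"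
proof -
  have "2 * theta 1 g - msym 1 0 * euler g \<in> sat N"
    using g by (intro sym.subspace_diff subspace_sat[OF N] subspace_numeral_mult sat_mult
       msym_Sym sat_euler[OF N] sat_theta[OF N]) auto
  also have "2 * theta 1 g - msym 1 0 * euler g = skew_euler g"
    by (simp add: msym_def theta_def euler_def skew_euler_def algebra_simps)
  finally show ?thesis .
qed

lemma skew_square_msym: "skew_square (msym i j) = cmult (of_nat ((nat \<bar>int i - int j\<bar>)\<^sup>2)) (msym i j)"
proof -
  \<comment> \<open>The eigenvalue is kept as the image of a natural number, so that injectivity of
    \<open>of_nat\<close> can separate eigenvalues later.\<close>
  have "(of_nat ((nat \<bar>int i - int j\<bar>)\<^sup>2) :: 'a sym_Wplus) = of_int (int ((nat \<bar>int i - int j\<bar>)\<^sup>2))"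
    by (simp only: of_int_of_nat_eq)
  also have "int ((nat \<bar>int i - int j\<bar>)\<^sup>2) = (int i - int j)\<^sup>2" by simp
  finally have e: "(of_nat ((nat \<bar>int i - int j\<bar>)\<^sup>2) :: 'a sym_Wplus) = (of_nat i - of_nat j)\<^sup>2" by simp
  show ?thesis unfolding cmult_of_nat e
    by (simp add: skew_square_def msym_def D_simps power2_eq_square algebra_simps)
qed

lemma skew_square_add: "skew_square (f + g) = skew_square f + skew_square g"
  by (simp add: skew_square_def D_simps)

lemma skew_square_cmult: "skew_square (cmult c f) = cmult c (skew_square f)"
  by (simp only: skew_square_def Ds_cmult Dt_cmult sym.scale_right_diff_distrib[symmetric])

lemma skew_square_0: "skew_square 0 = 0" and euler_0: "euler 0 = 0"
  by (simp_all add: skew_square_def euler_def D_simps)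

lemma skew_square_Sym: "g \<in> Sym \<Longrightarrow> skew_square g \<in> Sym"
  by (induction rule: Sym_induct)
    (auto simp: skew_square_0 skew_square_add skew_square_cmult skew_square_msym Sym_0 intro!: Sym_add Sym_cmult msym_Sym)

text \<open>Since \<open>Ds - Dt\<close> sends \<open>svar - tvar\<close> to
  \<open>svar + tvar\<close>, the square of \<open>skew_euler\<close> is
  \<open>disc * skew_square\<close> plus \<open>msym 1 0 * skew_euler\<close>; then
  \<open>disc\<close> is cancelled.\<close>

lemma sat_skew_square:
  assumes N: "act_subspace N" and g: "g \<in> sat N"
  shows "skew_square g \<in> sat N"
proof (rule sat_cancel_disc)
  have "skew_euler (skew_euler g) - msym 1 0 * skew_euler g \<in> sat N"
    using g by (intro sym.subspace_diff subspace_sat[OF N] sat_mult msym_Sym sat_skew_euler[OF N]) auto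
  also have "skew_euler (skew_euler g) - msym 1 0 * skew_euler g = disc * skew_square g"
    by (simp add: msym_def skew_euler_def skew_square_def disc_def D_simps power2_eq_square algebra_simps)
  finally show "disc * skew_square g \<in> sat N" .
qed (use g in \<open>simp add: skew_square_Sym sat_Sym\<close>)

section \<open>From a nonzero element to the unit of the saturation\<close>

lemma Sym_sum:
  assumes "f \<in> Sym"
  shows "\<exists>I c. finite I \<and> (\<forall>(i, j)\<in>I. i \<le> j) \<and> f = (\<Sum>(i, j)\<in>I. cmult (c (i, j)) (msym i j))"
  using assms
proof (induction rule: Sym_induct)
  case zero
  show ?case by (intro exI[of _ "{}"]) simp
next
  case (add d i j f)
  then obtain I c where I: "finite I" "\<forall>(i, j)\<in>I. i \<le> j" and f: "f = (\<Sum>(i, j)\<in>I. cmult (c (i, j)) (msym i j))"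
    by blast
  define p where "p = (min i j, max i j)"
  define c' where "c' q = (if q \<in> I then c q else 0) + (if q = p then d else 0)" for q
  have "f = (\<Sum>q\<in>insert p I. cmult (if q \<in> I then c q else 0) (msym (fst q) (snd q)))"
    unfolding f case_prod_unfold using I(1) by (intro sum.mono_neutral_cong_left) auto
  moreover have "cmult d (msym i j) = (\<Sum>q\<in>insert p I. cmult (if q = p then d else 0) (msym (fst q) (snd q)))"
  proof -
    have "msym i j = (msym (fst p) (snd p) :: 'a sym_Wplus)"
      by (simp add: p_def min_def max_def msym_commute)
    moreover have "(\<Sum>q\<in>insert p I. cmult (if q = p then d else 0) (msym (fst q) (snd q))) =
        (\<Sum>q\<in>{p}. cmult d (msym (fst q) (snd q)))"
      using I(1) by (intro sum.mono_neutral_cong_right) auto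
    ultimately show ?thesis by simp
  qed
  ultimately have "cmult d (msym i j) + f = (\<Sum>q\<in>insert p I. cmult (c' q) (msym (fst q) (snd q)))"
    by (simp add: c'_def sym.scale_left_distrib sum.distrib add.commute)
  moreover have "\<forall>(i, j)\<in>insert p I. i \<le> j" using I(2) by (auto simp: p_def)
  ultimately show ?case using I(1)
    by (intro exI[of _ "insert p I"] exI[of _ c']) (auto simp: case_prod_unfold)
qed

text \<open>Eigenvector separation: subtracting the eigenvalue at \<open>p\<close> from a diagonal
  operator removes \<open>p\<close> from the support and keeps any \<open>q\<close> with another
  eigenvalue, so the support shrinks to one pair.\<close>

lemma sat_msym:
  assumes N: "act_subspace N"
  shows "finite I \<Longrightarrow> I \<noteq> {} \<Longrightarrow> (\<forall>p\<in>I. fst p \<le> snd p \<and> c p \<noteq> 0) \<Longrightarrow>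
    (\<Sum>p\<in>I. cmult (c p) (msym (fst p) (snd p))) \<in> sat N \<Longrightarrow> \<exists>i j. msym i j \<in> sat N"
proof (induction "card I" arbitrary: I c rule: less_induct)
  case less
  note sub = subspace_sat[OF N]
  let ?m = "\<lambda>p. msym (fst p) (snd p)"
  let ?f = "\<Sum>p\<in>I. cmult (c p) (?m p)"
  from less.prems obtain p where p: "p \<in> I" by blast
  have step: "\<exists>i j. msym i j \<in> sat N"
    if T: "T ?f \<in> sat N" and Tsum: "T ?f = (\<Sum>q\<in>I. cmult (c q) (cmult (l q) (?m q)))"
      and q: "q \<in> I" "l q \<noteq> l p" for T l q
  proof (rule less.hyps)
    let ?I = "{r \<in> I. l r \<noteq> l p}"
    show "card ?I < card I"
      using p less.prems by (intro psubset_card_mono) auto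
    show "finite ?I" using less.prems by simp
    show "?I \<noteq> {}" using q by blast
    show "\<forall>r\<in>?I. fst r \<le> snd r \<and> c r * (l r - l p) \<noteq> 0"
      using less.prems by auto
    have "T ?f - cmult (l p) ?f \<in> sat N"
      using T less.prems by (intro sym.subspace_diff sym.subspace_scale sub)
    also have "T ?f - cmult (l p) ?f = (\<Sum>q\<in>I. cmult (c q * (l q - l p)) (?m q))"
      unfolding Tsum sym.scale_sum_right sum_subtractf[symmetric]
      by (simp add: right_diff_distrib sym.scale_left_diff_distrib mult.commute)
    also have "\<dots> = (\<Sum>q\<in>?I. cmult (c q * (l q - l p)) (?m q))"
      using less.prems by (intro sum.mono_neutral_right) auto
    finally show "(\<Sum>q\<in>?I. cmult (c q * (l q - l p)) (?m q)) \<in> sat N" .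
  qed
  have lin: "euler (\<Sum>p\<in>I. g p) = (\<Sum>p\<in>I. euler (g p))" "skew_square (\<Sum>p\<in>I. g p) = (\<Sum>p\<in>I. skew_square (g p))"
    for g :: "nat \<times> nat \<Rightarrow> 'a sym_Wplus"
    using less.prems(1) by (induction I rule: finite_induct) (simp_all add: euler_0 skew_square_0 euler_add skew_square_add)
  show ?case
  proof (cases "I = {p}")
    case True
    with less.prems have "cmult (c p) (?m p) \<in> sat N" and c: "c p \<noteq> 0" by auto
    from sym.subspace_scale[OF sub this(1), of "1 / c p"] have "?m p \<in> sat N" using c by simp
    then show ?thesis by blast
  next
    case False
    with p obtain q where q: "q \<in> I" "q \<noteq> p" by blast
    show ?thesis
    proof (cases "fst q + snd q = fst p + snd p")
      case False
      have "euler ?f = (\<Sum>q\<in>I. cmult (c q) (cmult (of_nat (fst q + snd q)) (?m q)))"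
        by (simp only: lin euler_cmult euler_msym)
      moreover have "(of_nat (fst q + snd q) :: 'a) \<noteq> of_nat (fst p + snd p)"
        using False by (simp only: of_nat_eq_iff not_False_eq_True)
      ultimately show ?thesis
        using step[of euler "\<lambda>q. of_nat (fst q + snd q)" q] q less.prems sat_euler[OF N] by blast
    next
      case True
      let ?l = "\<lambda>q. (nat \<bar>int (fst q) - int (snd q)\<bar>)\<^sup>2"
      \<comment> \<open>For ordered pairs, the sum and the absolute difference determine the
        pair.\<close>
      have "fst q \<le> snd q" "fst p \<le> snd p" using q p less.prems by auto
      with True q(2) have "nat \<bar>int (fst q) - int (snd q)\<bar> \<noteq> nat \<bar>int (fst p) - int (snd p)\<bar>"
        by (auto simp: prod_eq_iff)
      then have "?l q \<noteq> ?l p" by (simp add: power2_eq_iff)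
      then have "(of_nat (?l q) :: 'a) \<noteq> of_nat (?l p)" by (simp only: of_nat_eq_iff not_False_eq_True)
      moreover have "skew_square ?f = (\<Sum>q\<in>I. cmult (c q) (cmult (of_nat (?l q)) (?m q)))"
        by (simp only: lin skew_square_cmult skew_square_msym)
      ultimately show ?thesis
        using step[of skew_square "\<lambda>q. of_nat (?l q)" q] q less.prems sat_skew_square[OF N] by blast
    qed
  qed
qed

text \<open>After cancelling powers of \<open>st\<close>, a power sum lies in the saturation, and so
  does its image under \<open>skew_euler\<close>. Eliminating between them leaves
  \<open>4 * (disc * st ^ Suc e)\<close>, which cancels to 1.\<close>

lemma one_sat:
  fixes N :: "'k::field_char_0 sym_Wplus set"
  assumes N: "act_subspace N" and f: "f \<in> N" "f \<in> Sym" "f \<noteq> 0"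
  shows "1 \<in> sat N"
proof -
  note sub = subspace_sat[OF N]
  from Sym_sum[OF f(2)] obtain I c where I: "finite I" "\<forall>(i, j)\<in>I. i \<le> j"
    and fI: "f = (\<Sum>(i, j)\<in>I. cmult (c (i, j)) (msym i j))" by blast
  let ?I = "{p \<in> I. c p \<noteq> 0}"
  have fI': "f = (\<Sum>p\<in>?I. cmult (c p) (msym (fst p) (snd p)))"
    unfolding fI case_prod_unfold using I(1) by (intro sum.mono_neutral_cong_right) auto
  have "\<exists>i j. msym i j \<in> sat N"
  proof (rule sat_msym[OF N])
    show "?I \<noteq> {}" using fI' f(3) by (metis sum.empty)
    show "(\<Sum>p\<in>?I. cmult (c p) (msym (fst p) (snd p))) \<in> sat N"
      using sat_act_subspace[OF N f(1,2)] fI' by simp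
  qed (use I in auto)
  then obtain i j where "msym i j \<in> sat N" "i \<le> j"
    using msym_commute by (metis nat_le_linear)
  then have "st ^ i * msym 0 (j - i) \<in> sat N" by (simp add: st_msym)
  then have d: "msym (j - i) 0 \<in> sat N" (is "?P \<in> _")
    using sat_cancel_st_power msym_Sym msym_commute by metis
  show ?thesis
  proof (cases "j - i")
    case 0
    have "2 * 1 \<in> sat N" using d unfolding 0 by (simp add: msym_def)
    then show ?thesis by (rule subspace_numeral_cancel[OF sub])
  next
    case (Suc e)
    \<comment> \<open>\<open>w\<^sup>2 = d (P\<^sup>2 - 4 x\<^sup>m)\<close> for \<open>P = s\<^sup>m + t\<^sup>m\<close> and \<open>skew_euler P = m w\<close>.\<close>
    define w :: "'k sym_Wplus" where "w = (svar - tvar) * (svar ^ Suc e - tvar ^ Suc e)"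
    have "skew_euler ?P = of_nat (Suc e) * w"
      unfolding Suc skew_euler_def msym_def w_def by (simp add: D_simps algebra_simps)
    then have w: "w \<in> sat N"
      using sat_skew_euler[OF N d] subspace_of_nat_cancel[OF sub] by (metis nat.distinct(1))
    have "disc * (?P * ?P) - w * w \<in> sat N"
      using d w by (intro sym.subspace_diff sub sat_mult disc_Sym) (auto intro: sat_Sym)
    also have "disc * (?P * ?P) - w * w = 4 * (disc * st ^ Suc e)"
      unfolding Suc by (simp add: w_def msym_def disc_def st_def power2_eq_square power_mult_distrib algebra_simps)
    finally have "disc * st ^ Suc e \<in> sat N"
      by (rule subspace_numeral_cancel[OF sub])
    then have "st ^ Suc e \<in> sat N"
      by (rule sat_cancel_disc) (intro Sym_power st_Sym)
    then show ?thesis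
      using sat_cancel_st_power[of "Suc e" 1 N] Sym_1 by simp
  qed
qed

lemma act_subspace_contains:
  assumes N: "act_subspace N" and f: "f \<in> N" "f \<in> Sym" "f \<noteq> 0"
  shows "\<exists>n. \<forall>h\<in>Sym. st ^ Suc n * disc ^ Suc n * h \<in> N"
proof -
  from one_sat[OF assms] obtain n where n: "\<forall>h\<in>Sym. st ^ n * disc ^ n * h * 1 \<in> N"
    by (auto simp: sat_def)
  \<comment> \<open>The exponent is made positive so that the later descent can stop at
    \<open>st ^ 1\<close>.\<close>
  have "st ^ Suc n * disc ^ Suc n * h * 1 \<in> N" if "h \<in> Sym" for h
    by (rule sat_mono_exponent[OF n _ that]) simp
  then show ?thesis by (metis mult.right_neutral)
qed

subsection \<open>Layers\<close>

text \<open>The leading indices \<open>m\<close> of the elements of \<open>N i\<close> modulo \<open>F\<close> form a set that is empty or cofinite.\<close>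

lemma layer_stabilises:
  fixes N :: "nat \<Rightarrow> 'k::field_char_0 sym_Wplus set" and v :: "nat \<Rightarrow> 'k sym_Wplus"
  assumes N: "\<And>i. act_subspace (N i)" and mono: "mono N"
    and F: "sym.subspace F" "\<And>k f. 1 \<le> k \<Longrightarrow> f \<in> F \<Longrightarrow> act k f \<in> F"
    and v: "\<And>k m. 1 \<le> k \<Longrightarrow> \<exists>l. act k (v m) - cmult l (v (m + k)) \<in> F"
    and v_nz: "\<And>m. \<exists>K. \<forall>k>K. \<exists>l. l \<noteq> 0 \<and> act k (v m) - cmult l (v (m + k)) \<in> F"
    and stable: "\<exists>j. \<forall>i\<ge>j. N i \<inter> F \<subseteq> N j"
  shows "\<exists>j. \<forall>i\<ge>j. N i \<inter> (\<Union>m. sym.span (v ` {..<m} \<union> F)) \<subseteq> N j"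
proof -
  note sub = act_subspace_subspace[OF N]
  define low where "low m = sym.span (v ` {..<m} \<union> F)" for m
  define D where "D i = {m. \<exists>f\<in>N i. f - v m \<in> low m}" for i
  have low: "sym.subspace (low m)" for m by (simp add: low_def sym.subspace_span)
  have low_mono: "low m \<subseteq> low n" if "m \<le> n" for m n
    unfolding low_def using that by (intro sym.span_mono) auto
  have F_low: "f \<in> low m" if "f \<in> F" for f m
    unfolding low_def using that by (intro sym.span_base) auto
  have v_low: "v l \<in> low m" if "l < m" for l m
    unfolding low_def using that by (intro sym.span_base) auto
  have D_mono: "D i \<subseteq> D j" if "i \<le> j" for i j
    using monoD[OF mono that] by (auto simp: D_def)
  have act_low: "act k f \<in> low (m + k)" if k: "1 \<le> k" and f: "f \<in> low m" for k f m
    using f unfolding low_def[of m]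
  proof (induction rule: sym.span_induct_alt)
    case base
    have "act k (0 :: 'k sym_Wplus) = 0" by (simp add: act_def D_simps)
    then show ?case using sym.subspace_0[OF low] by simp
  next
    case (step c x y)
    have "act k x \<in> low (m + k)"
    proof (cases "x \<in> F")
      case True
      then show ?thesis using F k F_low by blast
    next
      case False
      with step obtain l where l: "l < m" "x = v l" by blast
      from v[OF k, of l] obtain c where "act k (v l) - cmult c (v (l + k)) \<in> low (m + k)"
        using F_low by blast
      moreover have "cmult c (v (l + k)) \<in> low (m + k)"
        using l by (intro sym.subspace_scale low v_low) simp
      ultimately show ?thesis
        using sym.subspace_add[OF low] l(2) by (metis diff_add_cancel)
    qed
    then show ?case
      using step by (auto simp: act_add act_cmult intro!: sym.subspace_add sym.subspace_scale low)
  qed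
  have D_act: "\<exists>K. \<forall>k>K. m + k \<in> D i" if m: "m \<in> D i" for m i
  proof -
    from m obtain f where f: "f \<in> N i" "f - v m \<in> low m" by (auto simp: D_def)
    from v_nz[of m] obtain K where K: "\<And>k. k > K \<Longrightarrow> \<exists>l. l \<noteq> 0 \<and> act k (v m) - cmult l (v (m + k)) \<in> F"
      by blast
    have "m + k \<in> D i" if k: "k > K" for k
    proof -
      from K[OF k] obtain l where l: "l \<noteq> 0" "act k (v m) - cmult l (v (m + k)) \<in> F" by blast
      \<comment> \<open>The lower terms of \<open>f\<close> stay below index \<open>m + k\<close>,
        so the leading term of \<open>act k f\<close> is \<open>cmult l (v (m + k))\<close>.\<close>
      have "act k (f - v m) + (act k (v m) - cmult l (v (m + k))) \<in> low (m + k)"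
        using f(2) k l(2) by (intro sym.subspace_add low act_low F_low[OF l(2)]) auto
      also have "act k (f - v m) + (act k (v m) - cmult l (v (m + k))) = act k f - cmult l (v (m + k))"
        using act_add[of k "f - v m" "v m"] by simp
      finally have "cmult (1 / l) (act k f - cmult l (v (m + k))) \<in> low (m + k)"
        by (rule sym.subspace_scale[OF low])
      then have "cmult (1 / l) (act k f) - v (m + k) \<in> low (m + k)"
        using l by (simp add: sym.scale_right_diff_distrib)
      moreover have "cmult (1 / l) (act k f) \<in> N i"
        using f k by (intro sym.subspace_scale sub act_subspace_act[OF N]) auto
      ultimately show ?thesis by (auto simp: D_def)
    qed
    then show ?thesis by blast
  qed
  have "\<exists>j. \<forall>i\<ge>j. D i \<subseteq> D j"
  proof (cases "\<exists>i. D i \<noteq> {}")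
    case False
    then show ?thesis by auto
  next
    case True
    then obtain i0 m where "m \<in> D i0" by blast
    with D_act obtain K where K: "\<And>k. k > K \<Longrightarrow> m + k \<in> D i0" by blast
    \<comment> \<open>Every index above \<open>m + K\<close> already lies in \<open>D i0\<close>.
      For the finitely many others, \<open>J l\<close> is a stage containing \<open>l\<close> if one
      exists; otherwise its arbitrary value does no harm to the maximum.\<close>
    define J where "J l = (SOME i. l \<in> D i)" for l
    have J: "l \<in> D (J l)" if "l \<in> D i" for l i
      unfolding J_def using that by (rule someI)
    define j where "j = Max (insert i0 (J ` {..m + K}))"
    have j: "i0 \<le> j" "\<And>l. l \<le> m + K \<Longrightarrow> J l \<le> j"
      unfolding j_def by (intro Max_ge; simp)+
    have "l \<in> D j" if "l \<in> D i" for l i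
    proof (cases "l \<le> m + K")
      case True
      then show ?thesis using J[OF that] D_mono j by blast
    next
      case False
      then show ?thesis using K[of "l - m"] D_mono[OF j(1)] by auto
    qed
    then show ?thesis by blast
  qed
  then obtain j1 where j1: "\<And>i. i \<ge> j1 \<Longrightarrow> D i \<subseteq> D j1" by blast
  from stable obtain j2 where j2: "\<And>i. i \<ge> j2 \<Longrightarrow> N i \<inter> F \<subseteq> N j2" by blast
  define j where "j = max j1 j2"
  \<comment> \<open>Induction on the leading index: an element of \<open>N j\<close> with the same
    leading term is subtracted.\<close>
  have "N i \<inter> low m \<subseteq> N j" if i: "i \<ge> j" for i m
  proof (induction m)
    case 0
    have "low 0 = F" unfolding low_def using F(1) by (simp add: sym.span_eq_iff)
    then show ?case using j2[of i] i monoD[OF mono, of j2 j] by (auto simp: j_def)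
  next
    case (Suc m)
    show ?case
    proof
      fix f assume f: "f \<in> N i \<inter> low (Suc m)"
      then have "f \<in> sym.span (insert (v m) (v ` {..<m} \<union> F))"
        by (simp add: low_def lessThan_Suc)
      then obtain c where c: "f - cmult c (v m) \<in> low m"
        unfolding sym.span_breakdown_eq low_def by blast
      show "f \<in> N j"
      proof (cases "c = 0")
        case True
        then show ?thesis using c f Suc by auto
      next
        case False
        have "cmult (1 / c) f - v m \<in> low m"
          using sym.subspace_scale[OF low c, of "1 / c"] False by (simp add: sym.scale_right_diff_distrib)
        moreover have "cmult (1 / c) f \<in> N i" using f by (intro sym.subspace_scale sub) auto
        ultimately have "m \<in> D i" by (auto simp: D_def)
        then have "m \<in> D j" using j1[of i] D_mono[of j1 j] i by (auto simp: j_def)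
        then obtain g where g: "g \<in> N j" "g - v m \<in> low m" by (auto simp: D_def)
        have "(f - cmult c (v m)) - cmult c (g - v m) \<in> low m"
          by (intro sym.subspace_diff sym.subspace_scale low c g)
        then have "f - cmult c g \<in> low m" by (simp add: sym.scale_right_diff_distrib)
        moreover have "f - cmult c g \<in> N i"
          using f g monoD[OF mono i] by (intro sym.subspace_diff sym.subspace_scale sub) auto
        ultimately have "f - cmult c g \<in> N j" using Suc by blast
        then have "(f - cmult c g) + cmult c g \<in> N j"
          using g by (intro sym.subspace_add sym.subspace_scale sub)
        then show ?thesis by simp
      qed
    qed
  qed
  then show ?thesis unfolding low_def by (intro exI[of _ j]) blast
qed

section \<open>Congruences modulo \<open>z\<close> and leading coefficients of the action\<close>

definition cong_mod :: "'k::field_char_0 sym_Wplus \<Rightarrow> 'k sym_Wplus \<Rightarrow> 'k sym_Wplus \<Rightarrow> bool" where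
  "cong_mod z f g \<longleftrightarrow> (\<exists>h\<in>Sym. f - g = z * h)"

lemma cong_mod_refl: "cong_mod z f f"
  unfolding cong_mod_def using Sym_0 by force

lemma cong_mod_add:
  assumes "cong_mod z f g" "cong_mod z f' g'"
  shows "cong_mod z (f + f') (g + g')"
proof -
  from assms obtain h h' where "h \<in> Sym" "h' \<in> Sym" "f - g = z * h" "f' - g' = z * h'"
    by (auto simp: cong_mod_def)
  then have "h + h' \<in> Sym" "(f + f') - (g + g') = z * (h + h')"
    by (auto simp: algebra_simps intro: Sym_add)
  then show ?thesis by (auto simp: cong_mod_def)
qed

lemma cong_mod_trans:
  assumes "cong_mod z f g" "cong_mod z g g'"
  shows "cong_mod z f g'"
  using cong_mod_add[OF assms] by (auto simp: cong_mod_def)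

lemma cong_mod_mult:
  assumes "cong_mod z f g" "u \<in> Sym"
  shows "cong_mod z (f * u) (g * u)"
proof -
  from assms obtain h where "h \<in> Sym" "f - g = z * h" by (auto simp: cong_mod_def)
  then have "h * u \<in> Sym" "f * u - g * u = z * (h * u)"
    using assms(2) by (auto simp: left_diff_distrib[symmetric] intro: Sym_mult)
  then show ?thesis by (auto simp: cong_mod_def)
qed

lemma cong_mod_cmult: "cong_mod z f g \<Longrightarrow> cong_mod z (cmult c f) (cmult c g)"
  using cong_mod_mult[of z f g "cmult c 1"] Sym_cmult[OF Sym_1, of c] by (simp add: cmult_mult_right)

lemma cong_mod_sum:
  "(\<And>i. i \<in> I \<Longrightarrow> cong_mod z (f i) (g i)) \<Longrightarrow> cong_mod z (\<Sum>i\<in>I. f i) (\<Sum>i\<in>I. g i)"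
  by (induction I rule: infinite_finite_induct) (auto intro: cong_mod_refl cong_mod_add)

text \<open>The difference of the two sides is minus the product of
  \<open>svar ^ i - tvar ^ i\<close> and \<open>svar ^ j - tvar ^ j\<close>; each factor is
  \<open>svar - tvar\<close> times a symmetric polynomial.\<close>

lemma msym_cong_disc: "cong_mod disc (msym i j) (msym (i + j) 0)"
proof -
  have 1: "\<exists>h\<in>Sym. svar ^ i - tvar ^ i = (svar - tvar :: 'a sym_Wplus) * h" for i
    using power_diff_hsum hsum_Sym Sym_0 by (cases i) force+
  from 1[of i] 1[of j] obtain h h' :: "'a sym_Wplus" where h: "h \<in> Sym" "h' \<in> Sym"
    "svar ^ i - tvar ^ i = (svar - tvar) * h" "svar ^ j - tvar ^ j = (svar - tvar) * h'" by blast
  have "msym i j - msym (i + j) 0 = - ((svar ^ i - tvar ^ i) * (svar ^ j - tvar ^ j) :: 'a sym_Wplus)"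
    by (simp add: msym_def power_add algebra_simps)
  also have "\<dots> = disc * cmult (- 1) (h * h')"
    unfolding h by (simp add: disc_def power2_eq_square algebra_simps)
  finally show ?thesis using h unfolding cong_mod_def by (blast intro: Sym_cmult Sym_mult)
qed

lemma msym_cong_st: "0 < i \<Longrightarrow> 0 < j \<Longrightarrow> cong_mod st (msym i j) 0"
  unfolding cong_mod_def
  by (intro bexI[OF _ msym_Sym[of "i - 1" "j - 1"]]) (simp add: st_msym[of 1, simplified])

text \<open>Passes from cofactors modulo \<open>z\<close> to the action modulo the next filtration
  step.\<close>

lemma act_weight_cong:
  assumes "cong_mod z (of_nat p * msym k 0 * g + of_nat q * (2 * hsum k) * g + theta k g - of_nat k * msym k 0 * g) (cmult l u)"
  shows "act k (st ^ p * disc ^ q * g) - cmult l (st ^ p * disc ^ q * u) \<in> (*) (st ^ p * disc ^ q * z) ` Sym"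
proof -
  from assms obtain h where h: "h \<in> Sym" 
    "of_nat p * msym k 0 * g + of_nat q * (2 * hsum k) * g + theta k g - of_nat k * msym k 0 * g = cmult l u + z * h"
    by (auto simp: cong_mod_def algebra_simps)
  have "act k (st ^ p * disc ^ q * g) - cmult l (st ^ p * disc ^ q * u) = st ^ p * disc ^ q * z * h"
    unfolding act_weight h(2) by (simp add: cmult_mult_right cmult_mult_left algebra_simps)
  with h(1) show ?thesis by blast
qed


lemma subspace_mult_Sym: "sym.subspace ((*) b ` Sym)"
proof (rule sym.subspaceI)
  show "0 \<in> (*) b ` Sym" using Sym_0 by force
next
  fix f g assume "f \<in> (*) b ` Sym" "g \<in> (*) b ` Sym"
  then show "f + g \<in> (*) b ` Sym" by (auto simp: distrib_left[symmetric] intro: Sym_add)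
next
  fix c f assume "f \<in> (*) b ` Sym"
  then show "cmult c f \<in> (*) b ` Sym" by (auto simp: cmult_mult_right[symmetric] intro: Sym_cmult)
qed

lemma act_weight_mem:
  assumes "f \<in> (*) (st ^ p * disc ^ q) ` Sym"
  shows "act k f \<in> (*) (st ^ p * disc ^ q) ` Sym"
proof -
  from assms obtain g where g: "g \<in> Sym" "f = st ^ p * disc ^ q * g" by blast
  have "of_nat p * msym k 0 * g + of_nat q * (2 * hsum k) * g + theta k g - of_nat k * msym k 0 * g \<in> Sym"
    unfolding mult.assoc using g(1)
    by (intro Sym_add Sym_diff Sym_of_nat_mult Sym_mult[OF msym_Sym] Sym_numeral_mult
        Sym_mult[OF hsum_Sym] theta_Sym)
  then show ?thesis unfolding g(2) act_weight by (rule imageI)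
qed

lemma weight_cong:
  fixes z :: "'k::field_char_0 sym_Wplus" and e e' :: 'k
  assumes "cong_mod z (msym k 0 * msym m 0) (cmult e (msym (m + k) 0))"
    and "cong_mod z (2 * hsum k * msym m 0) (cmult e' (msym (m + k) 0))"
  shows "cong_mod z (of_nat p * msym k 0 * msym m 0 + of_nat q * (2 * hsum k) * msym m 0
      + theta k (msym m 0) - of_nat k * msym k 0 * msym m 0)
    (cmult (of_nat p * e + of_nat q * e' + of_nat m - of_nat k * e) (msym (m + k) 0))"
proof -
  let ?M = "msym (m + k) 0 :: 'k sym_Wplus"
  have "cong_mod z (cmult (of_nat p - of_nat k) (msym k 0 * msym m 0) + cmult (of_nat q) (2 * hsum k * msym m 0)
      + cmult (of_nat m) ?M)
    (cmult (of_nat p - of_nat k) (cmult e ?M) + cmult (of_nat q) (cmult e' ?M) + cmult (of_nat m) ?M)"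
    by (intro cong_mod_add cong_mod_cmult assms cong_mod_refl)
  moreover have "cmult (of_nat p - of_nat k) (msym k 0 * msym m 0) + cmult (of_nat q) (2 * hsum k * msym m 0)
      + cmult (of_nat m) ?M = of_nat p * msym k 0 * msym m 0 + of_nat q * (2 * hsum k) * msym m 0
      + theta k (msym m 0) - of_nat k * msym k 0 * msym m 0"
    by (simp add: sym.scale_left_diff_distrib cmult_of_nat theta_msym algebra_simps)
  moreover have "cmult (of_nat p - of_nat k) (cmult e ?M) + cmult (of_nat q) (cmult e' ?M) + cmult (of_nat m) ?M =
      cmult (of_nat p * e + of_nat q * e' + of_nat m - of_nat k * e) ?M"
    by (simp add: sym.scale_left_distrib sym.scale_left_diff_distrib left_diff_distrib)
  ultimately show ?thesis by (simp only:)
qed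

text \<open>Modulo \<open>disc\<close> all orbit sums of one degree agree, so the
  \<open>k + 1\<close> summands of \<open>2 * hsum k\<close> contribute equally.\<close>

lemma weight_cong_disc:
  "cong_mod disc (of_nat p * msym k 0 * msym m 0 + of_nat q * (2 * hsum k) * msym m 0
      + theta k (msym m 0) - of_nat k * msym k 0 * msym m 0)
    (cmult (of_nat p * 2 + of_nat q * (2 * of_nat (Suc k)) + of_nat m - of_nat k * 2) (msym (m + k) 0))"
proof (rule weight_cong)
  have "cong_mod disc (msym (k + m) 0 + msym k m) (msym (k + m) 0 + msym (k + m) 0)"
    by (intro cong_mod_add cong_mod_refl msym_cong_disc)
  then show 1: "cong_mod disc (msym k 0 * msym m 0) (cmult 2 (msym (m + k) 0))"
    by (simp add: msym_mult cmult_numeral add.commute)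
  have "cong_mod disc (2 * hsum k) (\<Sum>i<Suc k. msym k 0)"
    unfolding two_hsum
  proof (rule cong_mod_sum)
    show "cong_mod disc (msym i (k - i)) (msym k 0)" if "i \<in> {..<Suc k}" for i
      using msym_cong_disc[of i "k - i"] that by simp
  qed
  then have "cong_mod disc (2 * hsum k * msym m 0) (cmult (of_nat (Suc k)) (msym k 0) * msym m 0)"
    by (intro cong_mod_mult msym_Sym) (simp only: cmult_of_nat sum_constant card_lessThan)
  moreover have "cong_mod disc (cmult (of_nat (Suc k)) (msym k 0) * msym m 0) (cmult (of_nat (Suc k)) (cmult 2 (msym (m + k) 0)))"
    unfolding cmult_mult_left by (intro cong_mod_cmult 1)
  ultimately show "cong_mod disc (2 * hsum k * msym m 0) (cmult (2 * of_nat (Suc k)) (msym (m + k) 0))"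
    by (auto dest: cong_mod_trans simp: mult.commute)
qed

text \<open>Modulo \<open>st\<close> only pure powers survive, so of \<open>2 * hsum k\<close> only
  the two end terms remain.\<close>

lemma weight_cong_st:
  assumes k: "1 \<le> k"
  shows "\<exists>e\<in>{1,2}. cong_mod st (of_nat p * msym k 0 * msym m 0 + of_nat q * (2 * hsum k) * msym m 0
      + theta k (msym m 0) - of_nat k * msym k 0 * msym m 0)
    (cmult (of_nat p * of_nat e + of_nat q * (2 * of_nat e) + of_nat m - of_nat k * of_nat e) (msym (m + k) 0))"
proof -
  \<comment> \<open>The value 2 at \<open>m = 0\<close> comes from \<open>msym 0 0 = 2\<close>; for
    other \<open>m\<close> the mixed term \<open>msym k m\<close> vanishes modulo
    \<open>st\<close>.\<close>
  define e :: nat where "e = (if m = 0 then 2 else 1)"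
  have 1: "cong_mod st (msym k 0 * msym m 0) (cmult (of_nat e) (msym (m + k) 0))"
  proof (cases "m = 0")
    case True
    then show ?thesis
      by (simp add: e_def msym_mult cmult_numeral cong_mod_refl)
  next
    case False
    have "cong_mod st (msym (k + m) 0 + msym k m) (msym (k + m) 0 + 0)"
      using k False by (intro cong_mod_add cong_mod_refl msym_cong_st) auto
    then show ?thesis using False by (simp add: e_def msym_mult add.commute)
  qed
  have "cong_mod st (2 * hsum k) (\<Sum>i<Suc k. (if i = 0 then msym k 0 else 0) + (if i = k then msym k 0 else 0))"
    unfolding two_hsum
  proof (rule cong_mod_sum)
    fix i assume "i \<in> {..<Suc k}"
    then consider "i = 0" | "i = k" "0 < i" | "0 < i" "0 < k - i" by fastforce
    then show "cong_mod st (msym i (k - i)) ((if i = 0 then msym k 0 else 0) + (if i = k then msym k 0 else 0))"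
      by cases (use k in \<open>auto simp: msym_commute[of 0] cong_mod_refl intro: msym_cong_st\<close>)
  qed
  also have "(\<Sum>i<Suc k. (if i = 0 then msym k 0 else 0) + (if i = k then msym k 0 else 0)) = cmult 2 (msym k 0)"
    unfolding sum.distrib by (simp add: sum.delta' cmult_numeral del: sum.lessThan_Suc)
  finally have "cong_mod st (2 * hsum k * msym m 0) (cmult 2 (msym k 0) * msym m 0)"
    by (intro cong_mod_mult msym_Sym)
  moreover have "cong_mod st (cmult 2 (msym k 0) * msym m 0) (cmult 2 (cmult (of_nat e) (msym (m + k) 0)))"
    unfolding cmult_mult_left by (intro cong_mod_cmult 1)
  ultimately have "cong_mod st (2 * hsum k * msym m 0) (cmult (2 * of_nat e) (msym (m + k) 0))"
    by (auto dest: cong_mod_trans)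
  from weight_cong[OF 1 this] show ?thesis
    by (intro bexI[of _ e]) (auto simp: e_def)
qed

section \<open>Descent through the filtration\<close>

definition stable_on :: "(nat \<Rightarrow> 'k::field_char_0 sym_Wplus set) \<Rightarrow> 'k sym_Wplus set \<Rightarrow> bool" where
  "stable_on N A \<longleftrightarrow> (\<exists>j. \<forall>i\<ge>j. N i \<inter> A \<subseteq> N j)"

text \<open>Shows that the union of spans controlled by \<open>layer_stabilises\<close> exhausts the
  filtration step.\<close>

lemma weight_low:
  fixes b z :: "'k::field_char_0 sym_Wplus"
  assumes cong: "\<And>i j. \<exists>n c. cong_mod z (msym i j) (cmult c (msym n 0))"
  shows "(*) b ` Sym \<subseteq> (\<Union>m. sym.span ((\<lambda>m. b * msym m 0) ` {..<m} \<union> (*) (b * z) ` Sym))"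
proof -
  let ?low = "\<lambda>m. sym.span ((\<lambda>m. b * msym m 0) ` {..<m} \<union> (*) (b * z) ` Sym)"
  have mono: "?low m \<subseteq> ?low n" if "m \<le> n" for m n
    using that by (intro sym.span_mono) auto
  have "\<exists>m. b * g \<in> ?low m" if "g \<in> Sym" for g
    using that
  proof (induction rule: Sym_induct)
    case zero
    then show ?case using sym.span_zero by auto
  next
    case (add c i j g)
    then obtain m where m: "b * g \<in> ?low m" by blast
    from cong[of i j] obtain n d h where h: "h \<in> Sym" "msym i j = cmult d (msym n 0) + z * h"
      by (auto simp: cong_mod_def algebra_simps)
    let ?m = "max m (Suc n)"
    have "b * msym n 0 \<in> ?low ?m" "b * z * h \<in> ?low ?m"
      using h(1) by (auto intro!: sym.span_base imageI)
    moreover have "b * g \<in> ?low ?m" using m mono[of m ?m] by auto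
    ultimately have "cmult c (cmult d (b * msym n 0) + b * z * h) + b * g \<in> ?low ?m"
      by (intro sym.span_add sym.span_scale)
    also have "cmult c (cmult d (b * msym n 0) + b * z * h) + b * g = b * (cmult c (msym i j) + g)"
      unfolding h(2) by (simp add: distrib_left cmult_mult_right mult.assoc)
    finally show ?case by blast
  qed
  then show ?thesis by blast
qed

text \<open>One descent step: stability on the smaller submodule, with
  \<open>layer_stabilises\<close> for the quotient, gives stability on the larger one.\<close>

lemma stable_on_weight:
  fixes N :: "nat \<Rightarrow> 'k::field_char_0 sym_Wplus set" and z :: "'k sym_Wplus"
  assumes N: "\<And>i. act_subspace (N i)" "mono N"
    and z: "st ^ p * disc ^ q * z = st ^ p' * disc ^ q'"
    and stable: "stable_on N ((*) (st ^ p' * disc ^ q') ` Sym)"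
    and cong: "\<And>i j. \<exists>n c. cong_mod z (msym i j) (cmult c (msym n 0))"
    and l: "\<And>k m. 1 \<le> k \<Longrightarrow> \<exists>l. (m + 2 * p + 2 * q < k \<longrightarrow> l \<noteq> 0) \<and>
       cong_mod z (of_nat p * msym k 0 * msym m 0 + of_nat q * (2 * hsum k) * msym m 0
         + theta k (msym m 0) - of_nat k * msym k 0 * msym m 0) (cmult l (msym (m + k) 0))"
  shows "stable_on N ((*) (st ^ p * disc ^ q) ` Sym)"
proof -
  let ?b = "st ^ p * disc ^ q :: 'k sym_Wplus" and ?F = "(*) (st ^ p * disc ^ q * z) ` Sym"
  let ?v = "\<lambda>m. ?b * msym m 0"
  have v: "\<exists>l. (m + 2 * p + 2 * q < k \<longrightarrow> l \<noteq> 0) \<and> act k (?v m) - cmult l (?v (m + k)) \<in> ?F"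
    if "1 \<le> k" for k m
    using l[OF that, of m] act_weight_cong by blast
  have "\<exists>j. \<forall>i\<ge>j. N i \<inter> (\<Union>m. sym.span (?v ` {..<m} \<union> ?F)) \<subseteq> N j"
  proof (rule layer_stabilises[OF N])
    show "sym.subspace ?F" by (rule subspace_mult_Sym)
    show "act k f \<in> ?F" if "f \<in> ?F" for k f
      using that unfolding z by (rule act_weight_mem)
    show "\<exists>l. act k (?v m) - cmult l (?v (m + k)) \<in> ?F" if "1 \<le> k" for k m
      using v[OF that] by blast
    \<comment> \<open>This threshold serves the \<open>disc\<close> layers and the \<open>st\<close>
      layers alike.\<close>
    show "\<exists>K. \<forall>k>K. \<exists>l. l \<noteq> 0 \<and> act k (?v m) - cmult l (?v (m + k)) \<in> ?F" for m
      using v by (intro exI[of _ "m + 2 * p + 2 * q"]) (metis Suc_leI One_nat_def gr_zeroI not_less_zero)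
    show "\<exists>j. \<forall>i\<ge>j. N i \<inter> ?F \<subseteq> N j"
      using stable unfolding z stable_on_def .
  qed
  then show ?thesis
    using weight_low[OF cong, of ?b] unfolding stable_on_def by (meson Int_mono order_refl order_trans)
qed

lemma stable_on_disc:
  fixes N :: "nat \<Rightarrow> 'k::field_char_0 sym_Wplus set"
  assumes N: "\<And>i. act_subspace (N i)" "mono N" and p: "1 \<le> p"
    and stable: "stable_on N ((*) (st ^ p * disc ^ Suc q) ` Sym)"
  shows "stable_on N ((*) (st ^ p * disc ^ q) ` Sym)"
proof (rule stable_on_weight[OF N _ stable])
  show "st ^ p * disc ^ q * disc = st ^ p * (disc :: 'k sym_Wplus) ^ Suc q" by (simp add: mult_ac)
  show "\<exists>n c. cong_mod (disc :: 'k sym_Wplus) (msym i j) (cmult c (msym n 0))" for i j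
    using msym_cong_disc[of i j] by (metis sym.scale_one)
  fix k m :: nat assume "1 \<le> k"
  let ?l = "of_nat p * 2 + of_nat q * (2 * of_nat (Suc k)) + of_nat m - of_nat k * 2"
  have "?l \<noteq> (0 :: 'k)" if "m + 2 * p + 2 * q < k"
  proof -
    \<comment> \<open>For \<open>q = 0\<close> the left side is below \<open>2 * k\<close>; for
      positive \<open>q\<close> it is at least \<open>2 * k + 2\<close>.\<close>
    have "p * 2 + q * (2 * Suc k) + m \<noteq> k * 2"
      using that p by (cases q) auto
    then have "(of_nat (p * 2 + q * (2 * Suc k) + m) :: 'k) \<noteq> of_nat (k * 2)"
      by (simp only: of_nat_eq_iff not_False_eq_True)
    then show ?thesis by (simp add: algebra_simps)
  qed
  then show "\<exists>l. (m + 2 * p + 2 * q < k \<longrightarrow> l \<noteq> 0) \<and>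
       cong_mod (disc :: 'k sym_Wplus) (of_nat p * msym k 0 * msym m 0 + of_nat q * (2 * hsum k) * msym m 0
         + theta k (msym m 0) - of_nat k * msym k 0 * msym m 0) (cmult l (msym (m + k) 0))"
    using weight_cong_disc by blast
qed

lemma stable_on_st:
  fixes N :: "nat \<Rightarrow> 'k::field_char_0 sym_Wplus set"
  assumes N: "\<And>i. act_subspace (N i)" "mono N"
    and stable: "stable_on N ((*) (st ^ Suc p * disc ^ q) ` Sym)"
  shows "stable_on N ((*) (st ^ p * disc ^ q) ` Sym)"
proof (rule stable_on_weight[OF N _ stable])
  show "st ^ p * disc ^ q * st = st ^ Suc p * (disc :: 'k sym_Wplus) ^ q" by (simp add: mult_ac)
  show "\<exists>n c. cong_mod (st :: 'k sym_Wplus) (msym i j) (cmult c (msym n 0))" for i j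
  proof -
    consider "i = 0" | "j = 0" | "0 < i" "0 < j" by blast
    then show ?thesis
    proof cases
      case 1
      then show ?thesis using cong_mod_refl msym_commute sym.scale_one by metis
    next
      case 2
      then show ?thesis using cong_mod_refl sym.scale_one by metis
    next
      case 3
      then show ?thesis using msym_cong_st sym.scale_zero_left by metis
    qed
  qed
  fix k m :: nat assume k: "1 \<le> k"
  from weight_cong_st[OF k, of p m q, where 'a = 'k] obtain e :: nat where e: "e \<in> {1, 2}"
    "cong_mod (st :: 'k sym_Wplus) (of_nat p * msym k 0 * msym m 0 + of_nat q * (2 * hsum k) * msym m 0
      + theta k (msym m 0) - of_nat k * msym k 0 * msym m 0)
    (cmult (of_nat p * of_nat e + of_nat q * (2 * of_nat e) + of_nat m - of_nat k * of_nat e) (msym (m + k) 0))"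
    by blast
  have "of_nat p * of_nat e + of_nat q * (2 * of_nat e) + of_nat m - of_nat k * of_nat e \<noteq> (0 :: 'k)"
    if "m + 2 * p + 2 * q < k"
  proof -
    \<comment> \<open>As \<open>e\<close> is positive, the left side is at most
      \<open>(p + 2 * q + m) * e\<close>, which is below \<open>k * e\<close>.\<close>
    have "p * e + q * (2 * e) + m \<noteq> k * e" using that e(1) by auto
    then have "(of_nat (p * e + q * (2 * e) + m) :: 'k) \<noteq> of_nat (k * e)"
      by (simp only: of_nat_eq_iff not_False_eq_True)
    then show ?thesis by simp
  qed
  with e(2) show "\<exists>l. (m + 2 * p + 2 * q < k \<longrightarrow> l \<noteq> 0) \<and>
       cong_mod (st :: 'k sym_Wplus) (of_nat p * msym k 0 * msym m 0 + of_nat q * (2 * hsum k) * msym m 0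
         + theta k (msym m 0) - of_nat k * msym k 0 * msym m 0) (cmult l (msym (m + k) 0))"
    by blast
qed

text \<open>Some \<open>N i0\<close> contains all symmetric multiples of a power of
  \<open>st * disc\<close>, so the chain is stable there. The exponent of \<open>st\<close> is then
  lowered to 1 and that of \<open>disc\<close> to 0, which reaches the whole module.\<close>

lemma act_subspace_acc:
  fixes N :: "nat \<Rightarrow> 'k::field_char_0 sym_Wplus set"
  assumes N: "\<And>i. act_subspace (N i)" "mono N" and V: "\<And>i. N i \<subseteq> (*) st ` Sym"
  shows "\<exists>j. \<forall>i\<ge>j. N i \<subseteq> N j"
proof (cases "\<exists>i. \<exists>f\<in>N i. f \<noteq> 0")
  case False
  then show ?thesis
    using sym.subspace_0[OF act_subspace_subspace[OF N(1)]] by (metis subsetI)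
next
  case True
  then obtain i0 f where f: "f \<in> N i0" "f \<noteq> 0" by blast
  then have "f \<in> Sym" using V st_Sym Sym_mult by blast
  from act_subspace_contains[OF N(1) f(1) this f(2)] obtain n
    where n: "\<forall>h\<in>Sym. st ^ Suc n * disc ^ Suc n * h \<in> N i0" by blast
  have "stable_on N ((*) (st ^ 1 * disc ^ Suc n) ` Sym)"
  proof (rule inc_induct[of 1 "Suc n"])
    show "stable_on N ((*) (st ^ Suc n * disc ^ Suc n) ` Sym)"
      unfolding stable_on_def using n by blast
    show "stable_on N ((*) (st ^ p * disc ^ Suc n) ` Sym)"
      if "stable_on N ((*) (st ^ Suc p * disc ^ Suc n) ` Sym)" for p
      using that by (rule stable_on_st[OF N])
  qed simp
  then have "stable_on N ((*) (st ^ 1 * disc ^ 0) ` Sym)"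
  proof (rule inc_induct[of 0 "Suc n", rotated])
    show "stable_on N ((*) (st ^ 1 * disc ^ q) ` Sym)"
      if "stable_on N ((*) (st ^ 1 * disc ^ Suc q) ` Sym)" for q
      using that by (rule stable_on_disc[OF N le_refl])
  qed simp
  then obtain j where "\<forall>i\<ge>j. N i \<inter> (*) st ` Sym \<subseteq> N j"
    unfolding stable_on_def by auto
  then show ?thesis using V by (metis inf.absorb1)
qed

subsection \<open>Quadratic elements\<close>

text \<open>Sends \<open>s\<^sup>i t\<^sup>j\<close> to \<open>x\<^sub>i x\<^sub>j\<close>; the values at monomials with \<open>i = 0\<close> or \<open>j = 0\<close> are junk.\<close>

definition to_quad :: "'k::field_char_0 sym_Wplus \<Rightarrow> 'k sym_Wplus" where
  "to_quad f = (\<Sum>m\<in>Poly_Mapping.keys f. cmult (Poly_Mapping.lookup f m)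
     (xvar (Poly_Mapping.lookup m 0) * xvar (Poly_Mapping.lookup m 1)))"

lemma to_quad_superset:
  assumes "finite A" "Poly_Mapping.keys f \<subseteq> A"
  shows "to_quad f = (\<Sum>m\<in>A. cmult (Poly_Mapping.lookup f m)
     (xvar (Poly_Mapping.lookup m 0) * xvar (Poly_Mapping.lookup m 1)))"
  unfolding to_quad_def using assms
  by (intro sum.mono_neutral_left) (auto simp: in_keys_iff)

lemma to_quad_add: "to_quad (f + g) = to_quad f + to_quad g"
  using keys_add[of f g]
  by (subst (1 2 3) to_quad_superset[of "Poly_Mapping.keys f \<union> Poly_Mapping.keys g"])
    (auto simp: lookup_add sym.scale_left_distrib sum.distrib)

lemma to_quad_0: "to_quad 0 = 0"
  by (simp add: to_quad_def)

lemma to_quad_single: "to_quad (Poly_Mapping.single m c) =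
    cmult c (xvar (Poly_Mapping.lookup m 0) * xvar (Poly_Mapping.lookup m 1))"
  by (cases "c = 0") (simp_all add: to_quad_def)

lemma to_quad_cmult: "to_quad (cmult c f) = cmult c (to_quad f)"
proof (induction f rule: sym_induct)
  case (single m d)
  have "cmult c (Poly_Mapping.single m d) = Poly_Mapping.single m (c * d)"
    by (simp add: cmult_def mult_single)
  then show ?case by (simp add: to_quad_single)
next
  case (add f g)
  then show ?case by (simp add: sym.scale_right_distrib to_quad_add)
qed

lemma to_quad_monomial: "to_quad (svar ^ i * tvar ^ j) = xvar i * xvar j"
proof -
  have 1: "svar ^ i = Poly_Mapping.single (Poly_Mapping.single 0 i) (1 :: 'a)" for i
    by (induction i) (simp_all add: svar_def xvar_def mult_single flip: single_add)
  have 2: "tvar ^ j = Poly_Mapping.single (Poly_Mapping.single 1 j) (1 :: 'a)" for j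
    by (induction j) (simp_all add: tvar_def xvar_def mult_single flip: single_add)
  show ?thesis unfolding 1 2 by (simp add: mult_single to_quad_single lookup_add lookup_single)
qed

lemma act_monomial:
  "act k (svar ^ i * tvar ^ j) = cmult (of_nat i - of_nat k) (svar ^ (i + k) * tvar ^ j)
     + cmult (of_nat j - of_nat k) (svar ^ i * tvar ^ (j + k))"
  by (simp add: act_def D_simps sym.scale_left_diff_distrib cmult_of_nat power_add algebra_simps)

text \<open>The Leibniz rule. The sign arises because \<open>act k\<close> models the bracket with
  \<open>xvar k\<close> in the first argument.\<close>

lemma to_quad_act_monomial:
  assumes "1 \<le> k" "1 \<le> i" "1 \<le> j"
  shows "to_quad (act k (svar ^ i * tvar ^ j)) = - pbracket (to_quad (svar ^ i * tvar ^ j)) (xvar k)"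
  unfolding act_monomial to_quad_add to_quad_cmult to_quad_monomial pbracket_mult_left
    pbracket_xvar[OF assms(2,1)] pbracket_xvar[OF assms(3,1)] cmult_mult_left cmult_mult_right
  by (simp add: sym.scale_left_diff_distrib)

lemma to_quad_act:
  assumes k: "1 \<le> k" and f: "f \<in> (*) st ` Sym"
  shows "to_quad (act k f) = - pbracket (to_quad f) (xvar k)"
proof -
  from f obtain g where g: "g \<in> Sym" "f = st * g" by blast
  have "to_quad (act k (st * g)) = - pbracket (to_quad (st * g)) (xvar k)"
    using g(1)
  proof (induction rule: Sym_induct)
    case zero
    have "pbracket 0 (xvar k) = (0 :: 'a sym_Wplus)"
      by (simp add: pbracket_def indets_def)
    then show ?case by (simp add: act_def D_simps to_quad_0)
  next
    case (add c i j g)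
    \<comment> \<open>The factor \<open>st\<close> makes all exponents positive, so the junk values
      of \<open>to_quad\<close> never occur.\<close>
    have e: "st * (cmult c (msym i j) + g) =
        cmult c (svar ^ Suc i * tvar ^ Suc j + svar ^ Suc j * tvar ^ Suc i) + st * g"
      by (simp only: distrib_left[of st] cmult_mult_right st_msym[of 1, simplified])
        (simp only: msym_def)
    show ?case using add k unfolding e
      by (simp add: to_quad_act_monomial act_add act_cmult to_quad_add to_quad_cmult pbracket_add_left pbracket_cmult_left
          sym.scale_right_distrib sym.scale_right_diff_distrib del: power_Suc)
  qed
  then show ?thesis by (simp add: g(2))
qed

lemma sym_square_to_quad: "sym_square \<subseteq> to_quad ` (*) st ` Sym"
proof
  fix f :: "'k::field_char_0 sym_Wplus" assume "f \<in> sym_square"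
  then show "f \<in> to_quad ` (*) st ` Sym"
    unfolding sym_square_def
  proof (induction rule: sym.span_induct_alt)
    case base
    have "to_quad (st * 0) \<in> to_quad ` (*) st ` (Sym :: 'k sym_Wplus set)" by (intro imageI Sym_0)
    then show ?case by (simp add: to_quad_0)
  next
    case (step c x y)
    from step(1) obtain i j where ij: "1 \<le> i" "1 \<le> j" "x = xvar i * xvar j"
      by (auto intro: order_trans)
    from step(2) obtain g where g: "g \<in> Sym" "y = to_quad (st * g)" by blast
    \<comment> \<open>Division by 2 compensates for the two terms of \<open>msym\<close>, and the
      lowered indices for the factor \<open>st\<close>.\<close>
    let ?g = "cmult (c / 2) (msym (i - 1) (j - 1)) + g"
    have "to_quad (st * ?g) = cmult (c / 2) (to_quad (msym i j)) + y"
      using ij(1,2)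
      by (simp add: distrib_left cmult_mult_right to_quad_add to_quad_cmult g(2) st_msym[of 1, simplified])
    also have "to_quad (msym i j) = cmult 2 x"
      by (simp add: msym_def to_quad_add to_quad_monomial ij(3) cmult_numeral mult.commute)
    finally have "to_quad (st * ?g) = cmult c x + y" by simp
    moreover have "?g \<in> Sym" using g(1) by (intro Sym_add Sym_cmult msym_Sym)
    ultimately show ?case by (metis imageI)
  qed
qed

section \<open>Chains of Poisson ideals\<close>

lemma poisson_ideal_subspace: "poisson_ideal I \<Longrightarrow> sym.subspace I"
  by (auto simp: poisson_ideal_def cmult_def intro!: sym.subspaceI)

theorem corollary4p8:
  fixes J :: "nat \<Rightarrow> 'k::field_char_0 sym_Wplus set"
  assumes chain: "\<And>i. J i \<subseteq> J (Suc i)"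
    and quadratic: "\<And>i. \<exists>G \<subseteq> sym_square. J i = poisson_ideal_generated G"
  shows "\<forall>\<^sub>F i in sequentially. J i = J (Suc i)"
proof -
  have J: "poisson_ideal (J i)" for i
    using quadratic[of i] poisson_ideal_generated_least(1) by metis
  note sub = poisson_ideal_subspace[OF J]
  have "mono J" using chain by (simp add: mono_iff_le_Suc)
  \<comment> \<open>The quadratic part of \<open>J i\<close>, pulled back along
    \<open>to_quad\<close> to a submodule of symmetric polynomials.\<close>
  define N where "N i = {f \<in> (*) st ` Sym. to_quad f \<in> J i}" for i
  have "act_subspace (N i)" for i
    unfolding act_subspace_def
  proof (intro conjI allI impI ballI)
    show "sym.subspace (N i)"
      using sym.subspace_0[OF sub] sym.subspace_0[OF subspace_mult_Sym, of st]
      by (intro sym.subspaceI) (auto simp: N_def to_quad_0 to_quad_add to_quad_cmult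
          intro!: sym.subspace_add[OF sub] sym.subspace_scale[OF sub]
            sym.subspace_add[OF subspace_mult_Sym] sym.subspace_scale[OF subspace_mult_Sym])
    fix k :: nat and f assume k: "1 \<le> k" and f: "f \<in> N i"
    have "act k f \<in> (*) st ` Sym" using act_weight_mem[of f 1 0 k] f by (simp add: N_def)
    moreover have "pbracket (to_quad f) (xvar k) \<in> J i" using f J[of i] by (simp add: N_def poisson_ideal_def)
    then have "to_quad (act k f) \<in> J i"
      using to_quad_act[OF k, of f] f sym.subspace_neg[OF sub, of "pbracket (to_quad f) (xvar k)"]
      by (auto simp: N_def)
    ultimately show "act k f \<in> N i" by (simp add: N_def)
  qed
  moreover have "mono N" using \<open>mono J\<close> by (force simp: N_def mono_def)
  ultimately obtain j where j: "\<And>i. i \<ge> j \<Longrightarrow> N i \<subseteq> N j"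
    using act_subspace_acc[of N] N_def by blast
  have "J i \<subseteq> J j" if i: "i \<ge> j" for i
  proof -
    from quadratic[of i] obtain G where G: "G \<subseteq> sym_square" "J i = poisson_ideal_generated G" by blast
    \<comment> \<open>Quadratic generators of \<open>J i\<close> have preimages in
      \<open>N i\<close>, which is contained in \<open>N j\<close>; this suffices because
      \<open>J j\<close> is a Poisson ideal.\<close>
    have "G \<subseteq> J j"
    proof
      fix g assume g: "g \<in> G"
      then obtain f where f: "f \<in> (*) st ` Sym" "g = to_quad f" using G(1) sym_square_to_quad by blast
      moreover have "g \<in> J i" using g G(2) poisson_ideal_generated_least(2) by blast
      ultimately show "g \<in> J j" using j[OF i] by (auto simp: N_def)
    qed
    then show ?thesis using poisson_ideal_generated_least(3)[OF J] G(2) by blast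
  qed
  then have "J i = J j" if "i \<ge> j" for i
    using that monoD[OF \<open>mono J\<close> that] by blast
  then show ?thesis
    unfolding eventually_sequentially by (metis le_SucI)
qed

end
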